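(* Let $\psi$ be a QCBF instance. Given a trace $T$ of $\psi$ with root label $(\emptyset,e)$, there exists a tree-like clause judgement proof $P$ of an empty clause such that the number of non-flow judgements in $P$ (viewed as a tree) equals the number of nodes of $T$. Moreover, the translation from $T$ to $P$ is computable in polynomial time.
   Context: A literal is a propositional variable $v$ or its negation $\overline{v}$; $v,\overline{v}$ are complementary. A clause is a disjunction of literals with at most one literal on each variable (also a set of literals); empty if it has no literals; $\mathrm{vars}(\alpha)$ is its set of variables. $\gamma$ is a resolvent of $\alpha,\beta$ if there is $L\in\alpha$ with complement $M\in\beta$ and $\gamma=(\alpha\setminus\{L\})\cup(\beta\setminus\{M\})$ is a clause. A clause $\gamma$ is falsified by assignment $a$ if $a$ is defined on $\mathrm{vars}(\gamma)$ and every literal of $\gamma$ is false under $a$. A QCBF instance is a propositional formula without free variables built from clauses, conjunction and $\forall/\exists$ quantification; $I_\psi$ has one index per subformula occurrence (a clause has no proper subformulas), $\psi(i)$ is the subformula at $i$, parent/child refer to the syntax tree. A clause judgement is $(i,\alpha)$ with $\mathrm{vars}(\alpha)\subseteq\mathrm{free}(\psi(i))$. A clause judgement proof is a finite sequence of clause judgements each of one of the types: (clause) $(i,\alpha)$ with $\psi(i)$ the clause $\alpha$; (resolve) $(i,\gamma)$ from previous $(i,\alpha),(i,\beta)$ with $\gamma$ a resolvent of $\alpha,\beta$; (upward flow) $(i,\alpha)$ from previous $(j,\alpha)$, $i$ the parent of $j$; ($\forall$-removal) $(i,\alpha\setminus\{y,\overline{y}\})$ from previous $(j,\alpha)$ with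 $\psi(i)=\forall y\,\psi(j)$, $i$ the parent of $j$; (downward flow) $(j,\alpha)$ from previous $(i,\alpha)$, $i$ the parent of $j$. Non-flow judgements are those not derived by (upward flow) or (downward flow). A judgement derived using a previous judgement $J$ is a successor of $J$, and $J$ a predecessor of it. A proof is tree-like if each judgement has at most one successor; then each judgement induces a tree rooted at it whose root's children are the trees of its predecessors; a tree-like proof of an empty clause is the tree induced by an empty clause judgement. $i\le_\psi j$ means $i$ lies on the path from $j$ to the root; $i<_\psi j$ means additionally $i\neq j$. A located variable is $(i,u)$ with $u$ quantified at location $i$; $\forall$-located if universally quantified. An index $j$ follows $(i,u)$ if $i<_\psi j$ and $u\in\mathrm{free}(\psi(k))$ for all $k$ with $i<_\psi k\le_\psi j$; a located variable $(j,v)$ follows $(i,u)$ if $j$ does; following a set $S$ means following each element. $S$ is coherent if of any two distinct elements one follows the other. $\mathrm{vars}(S)$ is the set of variables in $S$. $e$ is the unique assignment $\emptyset\to\{0,1\}$; $a\upharpoonright X$ is restriction and $a[u\to b]$ extension. A trace of $\psi$ is a rooted tree, each node labelled $(S,a)$ with $S$ a coherent set of located variables and $a:\mathrm{vars}(S)\to\{0,1\}$, each node having $0$, $1$ or $2$ children, such that: a node $(S,a)$ with $2$ children has children labelled $(S_0\cup\{(i,u)\},(a\upharpoonright\mathrm{vars}(S_0))[u\to 0])$ and $(S_1\cup\{(i,u)\},(a\upharpoonright\mathrm{vars}(S_1))[u\to 1])$ for some located variable $(i,u)\notin S$ with $S\cup\{(i,u)\}$ coherent and $S_0,S_1\subseteq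 S$ with $S_0\cup S_1=S$; a node with $1$ child has child labelled $(S\cup\{(i,y)\},a[y\to b])$ for some $\forall$-located $(i,y)$ following $S$ and $b\in\{0,1\}$; a node with $0$ children has an index $i$ following $S$ such that $\psi(i)$ is a clause falsified by $a$ with $\mathrm{vars}(\psi(i))=\mathrm{vars}(S)$. *)

theory Defs
  imports
    Main
    "HOL-Library.Sublist"
    "HOL-Library.List_Lexorder"
    "HOL-Library.Product_Lexorder"
begin

section \<open>Clauses and QCBF instances\<close>

text \<open>The pair \<open>(v, True)\<close> is the literal \<open>v\<close>, and \<open>(v, False)\<close> is its negation.\<close>

type_synonym var = nat
type_synonym literal = "var \<times> bool"
type_synonym clause = "literal set"

definition compl :: "literal \<Rightarrow> literal" where
  "compl L = (fst L, \<not> snd L)"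

definition vars :: "clause \<Rightarrow> var set" where
  "vars \<alpha> = fst ` \<alpha>"

definition is_clause :: "clause \<Rightarrow> bool" where
  "is_clause \<alpha> \<longleftrightarrow> finite \<alpha> \<and> (\<forall>L\<in>\<alpha>. \<forall>M\<in>\<alpha>. fst L = fst M \<longrightarrow> L = M)"

definition resolvent :: "clause \<Rightarrow> clause \<Rightarrow> clause \<Rightarrow> bool" where
  "resolvent \<alpha> \<beta> \<gamma> \<longleftrightarrow>
     (\<exists>L\<in>\<alpha>. \<exists>M\<in>\<beta>. M = compl L \<and> \<gamma> = (\<alpha> - {L}) \<union> (\<beta> - {M})) \<and> is_clause \<gamma>"

definition falsified :: "clause \<Rightarrow> (var \<rightharpoonup> bool) \<Rightarrow> bool" where
  "falsified \<gamma> a \<longleftrightarrow> vars \<gamma> \<subseteq> dom a \<and> (\<forall>(v, s)\<in>\<gamma>. a v = Some (\<not> s))"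

datatype qform =
    Clause clause
  | And qform qform
  | Forall var qform
  | Exists var qform

fun free :: "qform \<Rightarrow> var set" where
  "free (Clause \<alpha>) = vars \<alpha>"
| "free (And \<phi> \<chi>) = free \<phi> \<union> free \<chi>"
| "free (Forall v \<phi>) = free \<phi> - {v}"
| "free (Exists v \<phi>) = free \<phi> - {v}"

fun clauses_ok :: "qform \<Rightarrow> bool" where
  "clauses_ok (Clause \<alpha>) = is_clause \<alpha>"
| "clauses_ok (And \<phi> \<chi>) = (clauses_ok \<phi> \<and> clauses_ok \<chi>)"
| "clauses_ok (Forall v \<phi>) = clauses_ok \<phi>"
| "clauses_ok (Exists v \<phi>) = clauses_ok \<phi>"

definition qcbf :: "qform \<Rightarrow> bool" where
  "qcbf \<psi> \<longleftrightarrow> clauses_ok \<psi> \<and> free \<psi> = {}"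

text \<open>
  An index of a subformula occurrence is the path leading to it from the root of the syntax
  tree: \<open>False\<close> goes to the first conjunct, or to the body of a quantification, and \<open>True\<close> goes to
  the second conjunct. Hence \<open>i \<le>\<^sub>\<psi> j\<close> is \<^term>\<open>prefix i j\<close> and \<open>i <\<^sub>\<psi> j\<close> is
  \<^term>\<open>strict_prefix i j\<close>.
\<close>

type_synonym index = "bool list"

fun subf :: "qform \<Rightarrow> index \<Rightarrow> qform option" where
  "subf \<phi> [] = Some \<phi>"
| "subf (And \<phi> \<chi>) (d # i) = subf (if d then \<chi> else \<phi>) i"
| "subf (Forall v \<phi>) (False # i) = subf \<phi> i"
| "subf (Exists v \<phi>) (False # i) = subf \<phi> i"
| "subf _ _ = None"

definition indices :: "qform \<Rightarrow> index set" where
  "indices \<psi> = {i. subf \<psi> i \<noteq> None}"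

definition parent :: "index \<Rightarrow> index \<Rightarrow> bool" where
  "parent i j \<longleftrightarrow> (\<exists>d. j = i @ [d])"

definition free_at :: "qform \<Rightarrow> index \<Rightarrow> var set" where
  "free_at \<psi> i = free (the (subf \<psi> i))"


section \<open>Clause judgement proofs\<close>

type_synonym judgement = "index \<times> clause"

definition is_judgement :: "qform \<Rightarrow> judgement \<Rightarrow> bool" where
  "is_judgement \<psi> J \<longleftrightarrow>
     fst J \<in> indices \<psi> \<and> is_clause (snd J) \<and> vars (snd J) \<subseteq> free_at \<psi> (fst J)"

text \<open>
  The type of a judgement together with its predecessors. In a proof (a sequence) predecessors
  are given by their positions, in the tree induced by a judgement they are subtrees.
\<close>

datatype 'p step =
    By_Clause
  | Resolve 'p 'p
  | Up_Flow 'p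
  | Forall_Removal 'p
  | Down_Flow 'p

type_synonym cj_proof = "(judgement \<times> nat step) list"

text \<open>\<open>Js\<close> is the sequence of the previous judgements.\<close>

fun justified :: "qform \<Rightarrow> judgement list \<Rightarrow> judgement \<Rightarrow> nat step \<Rightarrow> bool" where
  "justified \<psi> Js (i, \<gamma>) By_Clause \<longleftrightarrow> subf \<psi> i = Some (Clause \<gamma>)"
| "justified \<psi> Js (i, \<gamma>) (Resolve m n) \<longleftrightarrow>
     m < length Js \<and> n < length Js \<and>
     (\<exists>\<alpha> \<beta>. Js ! m = (i, \<alpha>) \<and> Js ! n = (i, \<beta>) \<and> resolvent \<alpha> \<beta> \<gamma>)"
| "justified \<psi> Js (i, \<gamma>) (Up_Flow m) \<longleftrightarrow>
     m < length Js \<and> (\<exists>j. Js ! m = (j, \<gamma>) \<and> parent i j)"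
| "justified \<psi> Js (i, \<gamma>) (Forall_Removal m) \<longleftrightarrow>
     m < length Js \<and>
     (\<exists>j \<alpha> y \<phi>. Js ! m = (j, \<alpha>) \<and> parent i j \<and> subf \<psi> i = Some (Forall y \<phi>) \<and>
        \<gamma> = \<alpha> - {(y, True), (y, False)})"
| "justified \<psi> Js (j, \<gamma>) (Down_Flow m) \<longleftrightarrow>
     m < length Js \<and> (\<exists>i. Js ! m = (i, \<gamma>) \<and> parent i j)"

definition is_cj_proof :: "qform \<Rightarrow> cj_proof \<Rightarrow> bool" where
  "is_cj_proof \<psi> P \<longleftrightarrow>
     (\<forall>n<length P. is_judgement \<psi> (fst (P ! n)) \<and>
        justified \<psi> (map fst (take n P)) (fst (P ! n)) (snd (P ! n)))"

definition successors :: "cj_proof \<Rightarrow> nat \<Rightarrow> nat set" where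
  "successors P m = {n. n < length P \<and> m \<in> set_step (snd (P ! n))}"

definition tree_like :: "cj_proof \<Rightarrow> bool" where
  "tree_like P \<longleftrightarrow> (\<forall>m<length P. card (successors P m) \<le> 1)"

datatype ptree = PTree judgement "ptree step"

lemma rel_step_mono [mono]:
  "(\<And>x y. A x y \<longrightarrow> B x y) \<Longrightarrow> rel_step A s t \<longrightarrow> rel_step B s t"
  by (auto intro: step.rel_mono_strong)

text \<open>\<open>induces P n t\<close>: the tree induced by the \<open>n\<close>-th judgement of \<open>P\<close> is \<open>t\<close>.\<close>

inductive induces :: "cj_proof \<Rightarrow> nat \<Rightarrow> ptree \<Rightarrow> bool" for P where
  "n < length P \<Longrightarrow> P ! n = (J, s) \<Longrightarrow> rel_step (induces P) s s' \<Longrightarrow> induces P n (PTree J s')"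

definition tree_like_empty_clause_proof :: "qform \<Rightarrow> ptree \<Rightarrow> bool" where
  "tree_like_empty_clause_proof \<psi> t \<longleftrightarrow>
     (\<exists>P n i. is_cj_proof \<psi> P \<and> tree_like P \<and> n < length P \<and> fst (P ! n) = (i, {}) \<and>
        induces P n t)"

fun non_flow :: "ptree \<Rightarrow> nat" where
  "non_flow (PTree J By_Clause) = 1"
| "non_flow (PTree J (Resolve t u)) = 1 + non_flow t + non_flow u"
| "non_flow (PTree J (Up_Flow t)) = non_flow t"
| "non_flow (PTree J (Forall_Removal t)) = 1 + non_flow t"
| "non_flow (PTree J (Down_Flow t)) = non_flow t"


section \<open>Traces\<close>

type_synonym locvar = "index \<times> var"

definition forall_located :: "qform \<Rightarrow> locvar \<Rightarrow> bool" where
  "forall_located \<psi> p \<longleftrightarrow> (\<exists>\<phi>. subf \<psi> (fst p) = Some (Forall (snd p) \<phi>))"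

definition exists_located :: "qform \<Rightarrow> locvar \<Rightarrow> bool" where
  "exists_located \<psi> p \<longleftrightarrow> (\<exists>\<phi>. subf \<psi> (fst p) = Some (Exists (snd p) \<phi>))"

definition located :: "qform \<Rightarrow> locvar \<Rightarrow> bool" where
  "located \<psi> p \<longleftrightarrow> forall_located \<psi> p \<or> exists_located \<psi> p"

definition follows :: "qform \<Rightarrow> index \<Rightarrow> locvar \<Rightarrow> bool" where
  "follows \<psi> j p \<longleftrightarrow>
     j \<in> indices \<psi> \<and> strict_prefix (fst p) j \<and>
     (\<forall>k. strict_prefix (fst p) k \<and> prefix k j \<longrightarrow> snd p \<in> free_at \<psi> k)"

definition follows_set :: "qform \<Rightarrow> index \<Rightarrow> locvar set \<Rightarrow> bool" where
  "follows_set \<psi> j S \<longleftrightarrow> j \<in> indices \<psi> \<and> (\<forall>p\<in>S. follows \<psi> j p)"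

definition coherent :: "qform \<Rightarrow> locvar set \<Rightarrow> bool" where
  "coherent \<psi> S \<longleftrightarrow>
     (\<forall>p\<in>S. \<forall>q\<in>S. p \<noteq> q \<longrightarrow> follows \<psi> (fst p) q \<or> follows \<psi> (fst q) p)"

definition lvars :: "locvar set \<Rightarrow> var set" where
  "lvars S = snd ` S"

datatype trace = TNode "locvar set" "var \<rightharpoonup> bool" "trace list"

fun label :: "trace \<Rightarrow> locvar set \<times> (var \<rightharpoonup> bool)" where
  "label (TNode S a ts) = (S, a)"

fun nodes :: "trace \<Rightarrow> nat" where
  "nodes (TNode S a ts) = 1 + sum_list (map nodes ts)"

definition label_ok :: "qform \<Rightarrow> locvar set \<Rightarrow> (var \<rightharpoonup> bool) \<Rightarrow> bool" where
  "label_ok \<psi> S a \<longleftrightarrow> (\<forall>p\<in>S. located \<psi> p) \<and> coherent \<psi> S \<and> dom a = lvars S"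

text \<open>The children of a node are not ordered, so those of a branching may be listed either way.\<close>

inductive is_trace :: "qform \<Rightarrow> trace \<Rightarrow> bool" for \<psi> where
  leaf:
    "label_ok \<psi> S a \<Longrightarrow>
     follows_set \<psi> i S \<Longrightarrow> subf \<psi> i = Some (Clause \<alpha>) \<Longrightarrow> falsified \<alpha> a \<Longrightarrow> vars \<alpha> = lvars S \<Longrightarrow>
     is_trace \<psi> (TNode S a [])"
| one:
    "label_ok \<psi> S a \<Longrightarrow> is_trace \<psi> t \<Longrightarrow>
     forall_located \<psi> (i, y) \<Longrightarrow> follows_set \<psi> i S \<Longrightarrow>
     label t = (S \<union> {(i, y)}, a(y \<mapsto> b)) \<Longrightarrow>
     is_trace \<psi> (TNode S a [t])"
| two:
    "label_ok \<psi> S a \<Longrightarrow> is_trace \<psi> t0 \<Longrightarrow> is_trace \<psi> t1 \<Longrightarrow>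
     located \<psi> (i, u) \<Longrightarrow> (i, u) \<notin> S \<Longrightarrow> coherent \<psi> (S \<union> {(i, u)}) \<Longrightarrow>
     S0 \<subseteq> S \<Longrightarrow> S1 \<subseteq> S \<Longrightarrow> S0 \<union> S1 = S \<Longrightarrow>
     label t0 = (S0 \<union> {(i, u)}, (a |` lvars S0)(u \<mapsto> False)) \<Longrightarrow>
     label t1 = (S1 \<union> {(i, u)}, (a |` lvars S1)(u \<mapsto> True)) \<Longrightarrow>
     ts = [t0, t1] \<or> ts = [t1, t0] \<Longrightarrow>
     is_trace \<psi> (TNode S a ts)"


section \<open>Polynomial-time computability\<close>

text \<open>
  The model of computation is a first-order functional language over binary trees (in the style
  of the languages of N. D. Jones, \<^emph>\<open>Computability and Complexity from a Programming
  Perspective\<close>). A program is a list of function bodies, possibly mutually recursive, and function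
  \<open>0\<close> is the entry point; \<open>EArg n\<close> is the \<open>n\<close>-th argument of the current function.

  Every evaluation step costs at least the size of the value it yields (a conditional or a call
  adds one unit to the cost of the branch or body that yields its value). So in time \<open>t\<close> only
  values of size at most \<open>t\<close> arise and the recursion depth is at most \<open>t\<close>. Consequently there is
  a polynomial-time simulation by Turing machines, and vice versa: the functions computed in
  polynomial time are the usual ones. With unit cost this would fail, since sharing lets \<open>n\<close>
  applications of \<open>EDot\<close> build a tree of size exponential in \<open>n\<close>.
\<close>

datatype data = Atom | Dot data data

fun dsize :: "data \<Rightarrow> nat" where
  "dsize Atom = 1"
| "dsize (Dot x y) = 1 + dsize x + dsize y"

fun dfst :: "data \<Rightarrow> data" where
  "dfst Atom = Atom"
| "dfst (Dot x y) = x"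

fun dsnd :: "data \<Rightarrow> data" where
  "dsnd Atom = Atom"
| "dsnd (Dot x y) = y"

fun enc_bool :: "bool \<Rightarrow> data" where
  "enc_bool False = Atom"
| "enc_bool True = Dot Atom Atom"

datatype expr =
    EArg nat
  | EAtom
  | EDot expr expr
  | EFst expr
  | ESnd expr
  | EEq expr expr
  | EIf expr expr expr
  | ECall nat "expr list"

type_synonym program = "expr list"

text \<open>\<open>eval P xs e v t\<close>: with arguments \<open>xs\<close>, expression \<open>e\<close> evaluates to \<open>v\<close> in time \<open>t\<close>.\<close>

inductive eval :: "program \<Rightarrow> data list \<Rightarrow> expr \<Rightarrow> data \<Rightarrow> nat \<Rightarrow> bool"
  and evals :: "program \<Rightarrow> data list \<Rightarrow> expr list \<Rightarrow> data list \<Rightarrow> nat \<Rightarrow> bool"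
  for P where
  eval_Arg: "n < length xs \<Longrightarrow> eval P xs (EArg n) (xs ! n) (dsize (xs ! n))"
| eval_Atom: "eval P xs EAtom Atom 1"
| eval_Dot: "eval P xs e1 v1 t1 \<Longrightarrow> eval P xs e2 v2 t2 \<Longrightarrow>
    eval P xs (EDot e1 e2) (Dot v1 v2) (t1 + t2 + dsize (Dot v1 v2))"
| eval_Fst: "eval P xs e v t \<Longrightarrow> eval P xs (EFst e) (dfst v) (t + dsize (dfst v))"
| eval_Snd: "eval P xs e v t \<Longrightarrow> eval P xs (ESnd e) (dsnd v) (t + dsize (dsnd v))"
| eval_Eq: "eval P xs e1 v1 t1 \<Longrightarrow> eval P xs e2 v2 t2 \<Longrightarrow>
    eval P xs (EEq e1 e2) (enc_bool (v1 = v2)) (t1 + t2 + dsize (enc_bool (v1 = v2)))"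
| eval_If_True: "eval P xs e v t \<Longrightarrow> v \<noteq> Atom \<Longrightarrow> eval P xs e1 v1 t1 \<Longrightarrow>
    eval P xs (EIf e e1 e2) v1 (t + t1 + 1)"
| eval_If_False: "eval P xs e Atom t \<Longrightarrow> eval P xs e2 v2 t2 \<Longrightarrow>
    eval P xs (EIf e e1 e2) v2 (t + t2 + 1)"
| eval_Call: "f < length P \<Longrightarrow> evals P xs es vs t \<Longrightarrow> eval P vs (P ! f) v t' \<Longrightarrow>
    eval P xs (ECall f es) v (t + t' + 1)"
| evals_Nil: "evals P xs [] [] 0"
| evals_Cons: "eval P xs e v t \<Longrightarrow> evals P xs es vs t' \<Longrightarrow>
    evals P xs (e # es) (v # vs) (t + t')"

inductive_cases eval_elims:
  "eval P xs (EArg n) v t" "eval P xs EAtom v t" "eval P xs (EDot e1 e2) v t"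
  "eval P xs (EFst e) v t" "eval P xs (ESnd e) v t" "eval P xs (EEq e1 e2) v t"
  "eval P xs (EIf e e1 e2) v t" "eval P xs (ECall f es) v t"
  "evals P xs [] vs t" "evals P xs (e # es) vs t"

lemma eval_deterministic:
  "eval P xs e v t \<Longrightarrow> eval P xs e v' t' \<Longrightarrow> v' = v \<and> t' = t"
  "evals P xs es vs s \<Longrightarrow> evals P xs es vs' s' \<Longrightarrow> vs' = vs \<and> s' = s"
proof (induction arbitrary: v' t' and vs' s' rule: eval_evals.inducts)
  case eval_Arg then show ?case by (elim eval_elims) simp
next
  case eval_Atom then show ?case by (elim eval_elims) simp
next
  case eval_Dot then show ?case by (elim eval_elims) fastforce
next
  case eval_Fst then show ?case by (elim eval_elims) (metis (no_types, lifting))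
next
  case eval_Snd then show ?case by (elim eval_elims) (metis (no_types, lifting))
next
  case eval_Eq then show ?case by (elim eval_elims) (metis (no_types, lifting))
next
  case (eval_If_True xs e v t e1 v1 t1 e2)
  from eval_If_True.prems obtain w r r1
    where "eval P xs e w r" "w \<noteq> Atom \<Longrightarrow> eval P xs e1 v' r1" "w \<noteq> Atom \<Longrightarrow> t' = Suc (r + r1)"
    by (elim eval_elims(7)) blast+
  with eval_If_True.IH(2)[of w r] eval_If_True.IH(4)[of v' r1] eval_If_True.hyps show ?case
    by simp
next
  case (eval_If_False xs e t e2 v2 t2 e1)
  from eval_If_False.prems obtain w r r1
    where "eval P xs e w r" "w = Atom \<Longrightarrow> eval P xs e2 v' r1" "w = Atom \<Longrightarrow> t' = Suc (r + r1)"
    by (elim eval_elims(7)) blast+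
  with eval_If_False.IH(2)[of w r] eval_If_False.IH(4)[of v' r1] show ?case
    by simp
next
  case (eval_Call f xs es vs t v u)
  from eval_Call.prems obtain ws r r1
    where "evals P xs es ws r" "eval P ws (P ! f) v' r1" "t' = Suc (r + r1)"
    by (elim eval_elims(8)) blast
  with eval_Call.IH(3)[of ws r] eval_Call.IH(5)[of v' r1] show ?case
    by simp
next
  case evals_Nil then show ?case by (elim eval_elims) simp
next
  case (evals_Cons xs e v t es vs u)
  from evals_Cons.prems obtain w r ws r1
    where "eval P xs e w r" "evals P xs es ws r1" "vs' = w # ws" "s' = r + r1"
    by (elim eval_elims(10)) blast
  with evals_Cons.IH(2)[of w r] evals_Cons.IH(4)[of ws r1] show ?case
    by simp
qed

definition runs :: "program \<Rightarrow> data \<Rightarrow> data \<Rightarrow> nat \<Rightarrow> bool" where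
  "runs P x y t \<longleftrightarrow> P \<noteq> [] \<and> eval P [x] (P ! 0) y t"

text \<open>
  \<open>f\<close> is computable in polynomial time on the inputs in \<open>D\<close>, with respect to the given
  encodings of inputs and outputs.
\<close>

definition polytime_computable_on ::
    "'a set \<Rightarrow> ('a \<Rightarrow> data) \<Rightarrow> ('b \<Rightarrow> data) \<Rightarrow> ('a \<Rightarrow> 'b) \<Rightarrow> bool" where
  "polytime_computable_on D enc_in enc_out f \<longleftrightarrow>
     (\<exists>P c k. \<forall>x\<in>D. \<exists>t. runs P (enc_in x) (enc_out (f x)) t \<and>
        t \<le> c * dsize (enc_in x) ^ k + c)"


section \<open>Encodings\<close>

fun enc_list :: "data list \<Rightarrow> data" where
  "enc_list [] = Atom"
| "enc_list (x # xs) = Dot x (enc_list xs)"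

text \<open>Naturals in binary, least significant bit first.\<close>

fun bits :: "nat \<Rightarrow> bool list" where
  "bits n = (if n = 0 then [] else odd n # bits (n div 2))"

declare bits.simps [simp del]

definition enc_nat :: "nat \<Rightarrow> data" where
  "enc_nat n = enc_list (map enc_bool (bits n))"

text \<open>Finite sets as increasing lists; pairs and paths are ordered lexicographically.\<close>

definition enc_set :: "('a::linorder \<Rightarrow> data) \<Rightarrow> 'a set \<Rightarrow> data" where
  "enc_set enc A = enc_list (map enc (sorted_list_of_set A))"

definition enc_index :: "index \<Rightarrow> data" where
  "enc_index i = enc_list (map enc_bool i)"

definition enc_literal :: "literal \<Rightarrow> data" where
  "enc_literal L = Dot (enc_nat (fst L)) (enc_bool (snd L))"

definition enc_clause :: "clause \<Rightarrow> data" where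
  "enc_clause = enc_set enc_literal"

fun enc_qform :: "qform \<Rightarrow> data" where
  "enc_qform (Clause \<alpha>) = Dot (enc_nat 0) (enc_clause \<alpha>)"
| "enc_qform (And \<phi> \<chi>) = Dot (enc_nat 1) (Dot (enc_qform \<phi>) (enc_qform \<chi>))"
| "enc_qform (Forall v \<phi>) = Dot (enc_nat 2) (Dot (enc_nat v) (enc_qform \<phi>))"
| "enc_qform (Exists v \<phi>) = Dot (enc_nat 3) (Dot (enc_nat v) (enc_qform \<phi>))"

definition enc_locvar :: "locvar \<Rightarrow> data" where
  "enc_locvar p = Dot (enc_index (fst p)) (enc_nat (snd p))"

text \<open>The graph of an assignment is a set of pairs of a variable and a truth value.\<close>

definition enc_assignment :: "(var \<rightharpoonup> bool) \<Rightarrow> data" where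
  "enc_assignment a = enc_set (\<lambda>(v, b). Dot (enc_nat v) (enc_bool b)) (Map.graph a)"

fun enc_trace :: "trace \<Rightarrow> data" where
  "enc_trace (TNode S a ts) =
     Dot (enc_set enc_locvar S) (Dot (enc_assignment a) (enc_list (map enc_trace ts)))"

definition enc_input :: "qform \<times> trace \<Rightarrow> data" where
  "enc_input x = Dot (enc_qform (fst x)) (enc_trace (snd x))"

definition enc_judgement :: "judgement \<Rightarrow> data" where
  "enc_judgement J = Dot (enc_index (fst J)) (enc_clause (snd J))"

fun enc_ptree :: "ptree \<Rightarrow> data" where
  "enc_ptree (PTree J By_Clause) =
     Dot (enc_judgement J) (Dot (enc_nat 0) (enc_list []))"
| "enc_ptree (PTree J (Resolve t u)) =
     Dot (enc_judgement J) (Dot (enc_nat 1) (enc_list [enc_ptree t, enc_ptree u]))"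
| "enc_ptree (PTree J (Up_Flow t)) =
     Dot (enc_judgement J) (Dot (enc_nat 2) (enc_list [enc_ptree t]))"
| "enc_ptree (PTree J (Forall_Removal t)) =
     Dot (enc_judgement J) (Dot (enc_nat 3) (enc_list [enc_ptree t]))"
| "enc_ptree (PTree J (Down_Flow t)) =
     Dot (enc_judgement J) (Dot (enc_nat 4) (enc_list [enc_ptree t]))"

end

theory Submission
  imports Defs
begin

text \<open>
  The node \<open>(S, a)\<close> of a trace is turned into a derivation of the clause on \<open>vars(S)\<close> falsified by
  \<open>a\<close>. Coherence arranges \<open>S\<close> in a chain of locations, and the clause is derived at the body of
  the innermost quantification of \<open>S\<close>. A leaf is an input clause that flows up to this location, a
  node with one child is a \<open>\<forall>\<close>-removal followed by upward flow, and a node with two children lets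
  both clauses flow down to the deeper of the two locations, resolves them there and lets the
  resolvent flow up. All indices passed on the way have the variables of the clause free, because
  they lie between a quantification and an index that follows it.

  For the running time it suffices to bound the number of evaluation steps and the sizes of the
  values. All derivations built on the way are subtrees of the output, whose size is cubic in the
  size of the input.
\<close>

section \<open>Trees of judgements\<close>

text \<open>A trace label does not record which clause occurrence a leaf refers to, so the
  translation has to search for one below the location of the label. The search may end at another
  occurrence of the same clause than the one that witnesses the leaf; this is harmless, because its
  own path already guarantees the freeness that upward flow needs. The delicate index is the body of
  the innermost quantification. The conditions on a label give freeness strictly between that
  quantification and an index that follows the set, but by themselves they do not say that the
  innermost variable is free in the body. At that one index freeness is inherited from derivations
  already built for the children. For the running time, one bound \<open>M\<close> on all values is
  fixed in advance. Then every construct costs at most \<open>M\<close>, calls become rewrite rules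
  with a step count, and each function body is evaluated symbolically. Working space and output size
  both enter \<open>M\<close>, so the size of the output is estimated separately from the number of
  steps.\<close>

fun root :: "ptree \<Rightarrow> judgement" where
  "root (PTree J s) = J"

text \<open>These rules are local and mention no positions in a sequence, so derivations can be
  composed freely; the numbering is supplied once, by linearisation.\<close>

fun valid :: "qform \<Rightarrow> ptree \<Rightarrow> bool" where
  "valid \<psi> (PTree J By_Clause) \<longleftrightarrow> is_judgement \<psi> J \<and> subf \<psi> (fst J) = Some (Clause (snd J))"
| "valid \<psi> (PTree J (Resolve t u)) \<longleftrightarrow> is_judgement \<psi> J \<and> valid \<psi> t \<and> valid \<psi> u \<and>
     fst (root t) = fst J \<and> fst (root u) = fst J \<and>
     resolvent (snd (root t)) (snd (root u)) (snd J)"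
| "valid \<psi> (PTree J (Up_Flow t)) \<longleftrightarrow> is_judgement \<psi> J \<and> valid \<psi> t \<and>
     parent (fst J) (fst (root t)) \<and> snd (root t) = snd J"
| "valid \<psi> (PTree J (Forall_Removal t)) \<longleftrightarrow> is_judgement \<psi> J \<and> valid \<psi> t \<and>
     parent (fst J) (fst (root t)) \<and>
     (\<exists>y \<phi>. subf \<psi> (fst J) = Some (Forall y \<phi>) \<and>
        snd J = snd (root t) - {(y, True), (y, False)})"
| "valid \<psi> (PTree J (Down_Flow t)) \<longleftrightarrow> is_judgement \<psi> J \<and> valid \<psi> t \<and>
     parent (fst (root t)) (fst J) \<and> snd (root t) = snd J"

lemma valid_is_judgement: "valid \<psi> t \<Longrightarrow> is_judgement \<psi> (root t)"
  by (induction \<psi> t rule: valid.induct) auto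

section \<open>Linearising a tree into a tree-like sequence\<close>

fun step_refs :: "nat step \<Rightarrow> nat list" where
  "step_refs By_Clause = []"
| "step_refs (Resolve m n) = [m, n]"
| "step_refs (Up_Flow m) = [m]"
| "step_refs (Forall_Removal m) = [m]"
| "step_refs (Down_Flow m) = [m]"

lemma set_step_refs: "set (step_refs s) = set_step s"
  by (cases s) auto

definition refs :: "cj_proof \<Rightarrow> nat list" where
  "refs P = concat (map (\<lambda>x. step_refs (snd x)) P)"

lemma distinct_concat_nth_disjoint:
  "distinct (concat xss) \<Longrightarrow> m < n \<Longrightarrow> n < length xss \<Longrightarrow> set (xss ! m) \<inter> set (xss ! n) = {}"
proof (induction xss arbitrary: m n)
  case (Cons xs xss)
  from Cons.prems obtain n' where n: "n = Suc n'" "n' < length xss"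
    by (cases n) auto
  show ?case
  proof (cases m)
    case 0
    have "set (xss ! n') \<subseteq> set (concat xss)"
      using nth_mem[OF n(2)] by auto
    then show ?thesis
      using Cons.prems n 0 by auto
  next
    case (Suc m')
    then show ?thesis
      using Cons.IH[of m' n'] Cons.prems n by simp
  qed
qed simp

text \<open>Two successors of one position would put it into two different blocks of the
  concatenated reference list. Distinctness of that list is easier to maintain under concatenation
  than a count of successors.\<close>

lemma tree_like_if_distinct_refs:
  assumes "distinct (refs P)"
  shows "tree_like P"
proof -
  have "card (successors P m) \<le> 1" for m
  proof -
    have *: False if "a < b" "a \<in> successors P m" "b \<in> successors P m" for a b
      using distinct_concat_nth_disjoint[of "map (\<lambda>x. step_refs (snd x)) P" a b] assms that
      by (auto simp: refs_def successors_def set_step_refs)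
    have "a = b" if "a \<in> successors P m" "b \<in> successors P m" for a b
      using *[of a b] *[of b a] that by (meson linorder_neqE_nat)
    then show ?thesis
      by (simp add: card_le_Suc0_iff_eq successors_def)
  qed
  then show ?thesis
    by (simp add: tree_like_def)
qed

lemma induces_append: "induces P n t \<Longrightarrow> induces (P @ Q) n t"
proof (induction rule: induces.induct)
  case (1 n J s s')
  have "rel_step (induces (P @ Q)) s s'"
    using 1(3) by (rule step.rel_mono_strong) auto
  then show ?case
    using 1(1,2) by (intro induces.intros[where s = s]) (auto simp: nth_append)
qed

lemma is_cj_proof_snoc:
  "is_cj_proof \<psi> (P @ [(J, s)]) \<longleftrightarrow>
     is_cj_proof \<psi> P \<and> is_judgement \<psi> J \<and> justified \<psi> (map fst P) J s"
  by (auto simp: is_cj_proof_def nth_append less_Suc_eq)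

text \<open>Postorder linearisation; the references of the new part avoid \<open>P\<close> and the final position,
  so that linearisations can be concatenated.\<close>

definition linearises :: "qform \<Rightarrow> cj_proof \<Rightarrow> cj_proof \<Rightarrow> ptree \<Rightarrow> bool" where
  "linearises \<psi> P Q t \<longleftrightarrow> Q \<noteq> [] \<and> is_cj_proof \<psi> (P @ Q) \<and> distinct (refs Q) \<and>
     (\<forall>x\<in>set (refs Q). length P \<le> x \<and> Suc x < length P + length Q) \<and>
     fst (last Q) = root t \<and> induces (P @ Q) (length (P @ Q) - 1) t"

lemma last_nth_append: "Q \<noteq> [] \<Longrightarrow> (P @ Q) ! (length (P @ Q) - 1) = last Q"
  by (metis append_is_Nil_conv last_append last_conv_nth)

text \<open>Serves the three rules with one premise. The invariant leaves the last position of
  \<open>Q\<close> unreferenced, so the new step may refer to it, and the new last position is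
  unreferenced in turn.\<close>

lemma linearises_snoc:
  assumes "linearises \<psi> P Q t" "is_judgement \<psi> J"
    and "justified \<psi> (map fst (P @ Q)) J s" "rel_step (induces (P @ Q)) s s'"
    and "step_refs s = [length (P @ Q) - 1]"
  shows "linearises \<psi> P (Q @ [(J, s)]) (PTree J s')"
proof -
  have "is_cj_proof \<psi> ((P @ Q) @ [(J, s)])"
    using assms by (simp only: is_cj_proof_snoc linearises_def)
  moreover have "rel_step (induces ((P @ Q) @ [(J, s)])) s s'"
    using assms(4) by (rule step.rel_mono_strong) (rule induces_append)
  then have "induces ((P @ Q) @ [(J, s)]) (length (P @ Q)) (PTree J s')"
    by (intro induces.intros[where s = s]) (auto simp: nth_append)
  moreover have "refs (Q @ [(J, s)]) = refs Q @ [length (P @ Q) - 1]"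
    using assms(5) by (simp add: refs_def)
  moreover obtain q where "length Q = Suc q"
    using assms(1) by (cases Q) (auto simp: linearises_def)
  ultimately show ?thesis
    using assms(1) by (fastforce simp: linearises_def)
qed

lemma linearises_last:
  assumes "linearises \<psi> P Q t"
  shows "map fst (P @ Q) ! (length (P @ Q) - 1) = root t" "length (P @ Q) - 1 < length (P @ Q)"
  using assms last_nth_append[of Q P] by (auto simp: linearises_def nth_append last_conv_nth)

text \<open>The prefix \<open>P\<close> is arbitrary because at a resolution the second subtree is
  laid out behind the first one, with its references counted from there.\<close>

lemma valid_linearises:
  "valid \<psi> t \<Longrightarrow> is_cj_proof \<psi> P \<Longrightarrow> \<exists>Q. linearises \<psi> P Q t"
proof (induction \<psi> t arbitrary: P rule: valid.induct)
  case (1 \<psi> J)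
  obtain i \<alpha> where J: "J = (i, \<alpha>)" by fastforce
  have "induces (P @ [(J, By_Clause)]) (length P) (PTree J By_Clause)"
    by (intro induces.intros[where s = By_Clause]) auto
  then have "linearises \<psi> P [(J, By_Clause)] (PTree J By_Clause)"
    using 1 J by (simp add: linearises_def is_cj_proof_snoc refs_def)
  then show ?case ..
next
  case (2 \<psi> J t u)
  obtain i \<gamma> where J: "J = (i, \<gamma>)" by fastforce
  obtain Q where Q: "linearises \<psi> P Q t"
    using 2 by auto
  then have "is_cj_proof \<psi> (P @ Q)"
    by (simp add: linearises_def)
  then obtain R where R: "linearises \<psi> (P @ Q) R u"
    using 2 by fastforce
  define m n where mn: "m = length (P @ Q) - 1" "n = length (P @ Q @ R) - 1"
  obtain q r where len: "length Q = Suc q" "length R = Suc r"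
    using Q R by (cases Q; cases R) (auto simp: linearises_def)
  have "map fst (P @ Q) ! m = root t" "m < length (P @ Q)"
    using linearises_last[OF Q] by (auto simp: mn)
  then have m: "map fst (P @ Q @ R) ! m = root t" "m < length (P @ Q @ R)"
    by (auto simp: nth_append)
  have n: "map fst (P @ Q @ R) ! n = root u" "n < length (P @ Q @ R)"
    using linearises_last[OF R] by (auto simp: mn)
  have just: "justified \<psi> (map fst (P @ Q @ R)) J (Resolve m n)"
    using 2(3) m n J by (cases "root t"; cases "root u") auto
  have it: "induces (P @ Q @ R) m t" "induces (P @ Q @ R) n u"
    using Q R induces_append[of "P @ Q" m t R] by (auto simp: linearises_def mn)
  have proof': "is_cj_proof \<psi> ((P @ Q @ R) @ [(J, Resolve m n)])"
    using R just 2(3) by (simp only: is_cj_proof_snoc linearises_def) simp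
  moreover have "induces ((P @ Q @ R) @ [(J, Resolve m n)]) (length (P @ Q @ R))
      (PTree J (Resolve t u))"
    using it by (intro induces.intros[where s = "Resolve m n"]) (auto intro: induces_append[of "P @ Q @ R", simplified])
  moreover have "refs (Q @ R @ [(J, Resolve m n)]) = refs Q @ refs R @ [m, n]"
    by (simp add: refs_def)
  \<comment> \<open>\<open>m\<close> and \<open>n\<close> are the final positions of the two blocks.
    References inside \<open>Q\<close> lie below \<open>m\<close>, those inside \<open>R\<close>
    strictly between \<open>m\<close> and \<open>n\<close>, so the three groups cannot meet.\<close>
  moreover have "distinct (refs Q @ refs R @ [m, n])"
  proof -
    have "m < n"
      using len by (simp add: mn)
    moreover have "distinct (refs Q)" "distinct (refs R)"
      using Q R by (simp_all add: linearises_def)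
    moreover have "x < m" if "x \<in> set (refs Q)" for x
      using Q len that by (fastforce simp: linearises_def mn)
    moreover have "m < x \<and> x < n" if "x \<in> set (refs R)" for x
      using R len that by (fastforce simp: linearises_def mn)
    ultimately show ?thesis
      by fastforce
  qed
  moreover have "\<forall>x\<in>set (refs Q @ refs R @ [m, n]). length P \<le> x \<and> x < length (P @ Q @ R)"
    using Q R len by (fastforce simp: linearises_def mn)
  ultimately have "linearises \<psi> P (Q @ R @ [(J, Resolve m n)]) (PTree J (Resolve t u))"
    by (simp add: linearises_def)
  then show ?case ..
next
  case (3 \<psi> J t)
  then obtain Q where Q: "linearises \<psi> P Q t" by auto
  have "linearises \<psi> P (Q @ [(J, Up_Flow (length (P @ Q) - 1))]) (PTree J (Up_Flow t))"
    using 3 linearises_last[OF Q] Q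
    by (intro linearises_snoc[OF Q]; cases J; cases "root t") (auto simp: linearises_def)
  then show ?case ..
next
  case (4 \<psi> J t)
  then obtain Q where Q: "linearises \<psi> P Q t" by auto
  have "linearises \<psi> P (Q @ [(J, Forall_Removal (length (P @ Q) - 1))]) (PTree J (Forall_Removal t))"
    using 4 linearises_last[OF Q] Q
    by (intro linearises_snoc[OF Q]; cases J; cases "root t") (auto simp: linearises_def)
  then show ?case ..
next
  case (5 \<psi> J t)
  then obtain Q where Q: "linearises \<psi> P Q t" by auto
  have "linearises \<psi> P (Q @ [(J, Down_Flow (length (P @ Q) - 1))]) (PTree J (Down_Flow t))"
    using 5 linearises_last[OF Q] Q
    by (intro linearises_snoc[OF Q]; cases J; cases "root t") (auto simp: linearises_def)
  then show ?case ..
qed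

lemma valid_tree_like_empty_clause_proof:
  assumes "valid \<psi> t" "snd (root t) = {}"
  shows "tree_like_empty_clause_proof \<psi> t"
proof -
  have "is_cj_proof \<psi> []"
    by (simp add: is_cj_proof_def)
  then obtain P where P: "linearises \<psi> [] P t"
    using valid_linearises[OF assms(1)] by blast
  then have "P \<noteq> []" "is_cj_proof \<psi> P" "tree_like P" "induces P (length P - 1) t"
    and "fst (P ! (length P - 1)) = (fst (root t), {})"
    using assms(2) by (auto simp: linearises_def tree_like_if_distinct_refs last_conv_nth prod_eq_iff)
  then show ?thesis
    unfolding tree_like_empty_clause_proof_def by (metis diff_less length_greater_0_conv less_one)
qed

section \<open>Translation of traces\<close>

lemma subf_Forall_Cons: "subf (Forall v \<phi>) (d # i) = (if d then None else subf \<phi> i)"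
  by (cases d) auto

lemma subf_Exists_Cons: "subf (Exists v \<phi>) (d # i) = (if d then None else subf \<phi> i)"
  by (cases d) auto

lemma subf_append: "subf \<psi> (i @ j) = Option.bind (subf \<psi> i) (\<lambda>\<phi>. subf \<phi> j)"
  by (induction \<psi> i rule: subf.induct) auto

lemma indices_prefix: "j \<in> indices \<psi> \<Longrightarrow> prefix i j \<Longrightarrow> i \<in> indices \<psi>"
  by (auto simp: indices_def prefix_def subf_append bind_eq_Some_conv)

definition falsified_clause :: "(var \<rightharpoonup> bool) \<Rightarrow> clause" where
  "falsified_clause a = (\<lambda>(v, b). (v, \<not> b)) ` Map.graph a"

lemma mem_falsified_clause: "(v, s) \<in> falsified_clause a \<longleftrightarrow> a v = Some (\<not> s)"
  by (force simp: falsified_clause_def Map.graph_def)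

lemma vars_falsified_clause: "vars (falsified_clause a) = dom a"
proof -
  have "v \<in> vars (falsified_clause a)" if "a v = Some b" for v b
    using that mem_falsified_clause[of v "\<not> b" a] by (force simp: vars_def)
  then show ?thesis
    by (auto simp: vars_def mem_falsified_clause)
qed

lemma is_clause_falsified_clause: "finite (dom a) \<Longrightarrow> is_clause (falsified_clause a)"
  by (auto simp: is_clause_def mem_falsified_clause)
    (simp add: falsified_clause_def finite_graph_iff_finite_dom)

text \<open>Falsification fixes the sign of every literal and the domain fixes the variables, so the
  clause of a leaf can be read off its label.\<close>

lemma falsified_imp_eq_falsified_clause:
  assumes "falsified \<alpha> a" "vars \<alpha> = dom a"
  shows "\<alpha> = falsified_clause a"
proof -
  have "(v, s) \<in> \<alpha>" if "a v = Some (\<not> s)" for v s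
  proof -
    have "v \<in> vars \<alpha>"
      using assms(2) that by auto
    then obtain s' where "(v, s') \<in> \<alpha>"
      by (auto simp: vars_def)
    then show ?thesis
      using assms(1) that by (auto simp: falsified_def)
  qed
  then show ?thesis
    using assms(1) by (auto simp: falsified_def mem_falsified_clause)
qed

text \<open>In a coherent set the elements form a chain of locations, and the lexicographically greatest
  one is the innermost one. The clause of a trace node lives at the body of that quantification.\<close>

definition loc :: "locvar set \<Rightarrow> index" where
  "loc S = (if S = {} then [] else fst (Max S))"

definition body_loc :: "locvar set \<Rightarrow> index" where
  "body_loc S = (if S = {} then [] else loc S @ [False])"

fun up_chain :: "index \<Rightarrow> index \<Rightarrow> clause \<Rightarrow> ptree \<Rightarrow> ptree" where
  "up_chain j [] C t = t"
| "up_chain j (d # r) C t = PTree (j, C) (Up_Flow (up_chain (j @ [d]) r C t))"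

text \<open>Accumulating, in contrast to \<open>up_chain\<close>: here the root of the result
  carries the deepest index, so judgements are wrapped around \<open>t\<close> in the order in which
  the path is walked.\<close>

fun down_chain :: "index \<Rightarrow> index \<Rightarrow> clause \<Rightarrow> ptree \<Rightarrow> ptree" where
  "down_chain j [] C t = t"
| "down_chain j (d # r) C t = down_chain (j @ [d]) r C (PTree (j @ [d], C) (Down_Flow t))"

text \<open>Never passing a quantification of a variable of \<open>C\<close> keeps these variables free along the whole
  path, as the upward flow of \<open>C\<close> requires.\<close>

fun find_clause :: "clause \<Rightarrow> qform \<Rightarrow> index option" where
  "find_clause C (Clause \<alpha>) = (if \<alpha> = C then Some [] else None)"
| "find_clause C (And \<phi> \<chi>) =
     (case find_clause C \<phi> of
        Some r \<Rightarrow> Some (False # r)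
      | None \<Rightarrow> map_option (Cons True) (find_clause C \<chi>))"
| "find_clause C (Forall v \<phi>) =
     (if v \<in> vars C then None else map_option (Cons False) (find_clause C \<phi>))"
| "find_clause C (Exists v \<phi>) =
     (if v \<in> vars C then None else map_option (Cons False) (find_clause C \<phi>))"

text \<open>Comparing lengths by dropping suits the program, which has no arithmetic. In a tie the
  result is \<open>i\<close>.\<close>

definition longer :: "'a list \<Rightarrow> 'a list \<Rightarrow> 'a list" where
  "longer i j = (if drop (length i) j = [] then i else j)"

abbreviation trace_set :: "trace \<Rightarrow> locvar set" where
  "trace_set t \<equiv> fst (label t)"

abbreviation trace_clause :: "trace \<Rightarrow> clause" where
  "trace_clause t \<equiv> falsified_clause (snd (label t))"

definition leaf_path :: "qform \<Rightarrow> index \<Rightarrow> clause \<Rightarrow> index" where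
  "leaf_path \<psi> j C = the (find_clause C (the (subf \<psi> j)))"

definition leaf_tree :: "qform \<Rightarrow> index \<Rightarrow> clause \<Rightarrow> ptree" where
  "leaf_tree \<psi> j C =
     up_chain j (leaf_path \<psi> j C) C (PTree (j @ leaf_path \<psi> j C, C) By_Clause)"

text \<open>Where this is applied, \<open>j\<close> is a prefix of \<open>i\<close>, so
  \<open>drop (length j) i\<close> is the path from \<open>j\<close> down to \<open>i\<close>. The
  same holds in the next two definitions.\<close>

definition removal_tree :: "index \<Rightarrow> index \<Rightarrow> clause \<Rightarrow> ptree \<Rightarrow> ptree" where
  "removal_tree j i C t = up_chain j (drop (length j) i) C (PTree (i, C) (Forall_Removal t))"

definition lower :: "index \<Rightarrow> index \<Rightarrow> clause \<Rightarrow> ptree \<Rightarrow> ptree" where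
  "lower j i C t = down_chain j (drop (length j) i) C t"

definition resolution_tree :: "index \<Rightarrow> index \<Rightarrow> clause \<Rightarrow> ptree \<Rightarrow> ptree \<Rightarrow> ptree" where
  "resolution_tree j i C t u = up_chain j (drop (length j) i) C (PTree (i, C) (Resolve t u))"

text \<open>Children are taken in list order, whichever of them sets the variable to false. The last
  equation only makes the function total: a trace node has at most two children.\<close>

fun translate :: "qform \<Rightarrow> trace \<Rightarrow> ptree" where
  "translate \<psi> (TNode S a []) = leaf_tree \<psi> (body_loc S) (falsified_clause a)"
| "translate \<psi> (TNode S a [t]) =
     removal_tree (body_loc S) (loc (trace_set t)) (falsified_clause a) (translate \<psi> t)"
| "translate \<psi> (TNode S a [t, u]) =
     (let j = body_loc (trace_set t); k = body_loc (trace_set u); i = longer j k in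
      resolution_tree (body_loc S) i (falsified_clause a)
        (lower j i (trace_clause t) (translate \<psi> t))
        (lower k i (trace_clause u) (translate \<psi> u)))"
| "translate \<psi> (TNode S a (t # u # w # ts)) = undefined"

section \<open>Flow chains and the search for a clause\<close>

lemma up_chain_valid:
  assumes "valid \<psi> t" "root t = (j @ r, C)"
    and "\<And>k. strict_prefix k r \<Longrightarrow> is_judgement \<psi> (j @ k, C)"
  shows "valid \<psi> (up_chain j r C t) \<and> root (up_chain j r C t) = (j, C) \<and>
    non_flow (up_chain j r C t) = non_flow t"
  using assms
proof (induction j r C t rule: up_chain.induct)
  case (2 j d r C t)
  have "is_judgement \<psi> ((j @ [d]) @ k, C)" if "strict_prefix k r" for k
    using 2(4)[of "d # k"] that by simp
  then show ?case
    using 2(1-3) 2(4)[of "[]"] by (simp add: parent_def)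
qed simp

lemma down_chain_valid:
  assumes "valid \<psi> t" "root t = (j, C)"
    and "\<And>k. prefix k r \<Longrightarrow> is_judgement \<psi> (j @ k, C)"
  shows "valid \<psi> (down_chain j r C t) \<and> root (down_chain j r C t) = (j @ r, C) \<and>
    non_flow (down_chain j r C t) = non_flow t"
  using assms
proof (induction j r C t rule: down_chain.induct)
  case (2 j d r C t)
  have "is_judgement \<psi> ((j @ [d]) @ k, C)" if "prefix k r" for k
    using 2(4)[of "d # k"] that by simp
  then show ?case
    using 2(1-3) 2(4)[of "[d]"] by (simp add: parent_def)
qed simp

lemma all_prefix_Cons:
  "(\<forall>k. prefix k (d # r) \<longrightarrow> Q k) \<longleftrightarrow> Q [] \<and> (\<forall>k. prefix k r \<longrightarrow> Q (d # k))"
  by (auto simp: prefix_Cons)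

lemma free_at_simps:
  "free_at \<phi> [] = free \<phi>"
  "free_at (And \<phi> \<chi>) (d # i) = free_at (if d then \<chi> else \<phi>) i"
  "free_at (Forall v \<phi>) (False # i) = free_at \<phi> i"
  "free_at (Exists v \<phi>) (False # i) = free_at \<phi> i"
  by (simp_all add: free_at_def)

text \<open>The variables of \<open>C\<close> are free at the clause found. Going up, a conjunction
  only adds free variables, and a quantification that the search passes binds none of
  \<open>C\<close>.\<close>

lemma find_clause_sound:
  "find_clause C \<phi> = Some r \<Longrightarrow>
     subf \<phi> r = Some (Clause C) \<and> vars C \<subseteq> free \<phi> \<and>
     (\<forall>k. prefix k r \<longrightarrow> vars C \<subseteq> free_at \<phi> k)"
proof (induction C \<phi> arbitrary: r rule: find_clause.induct)
  case (1 C \<alpha>)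
  then show ?case by (auto simp: free_at_simps split: if_splits)
next
  case (2 C \<phi> \<chi>)
  show ?case
  proof (cases "find_clause C \<phi>")
    case None
    with 2(3) obtain s where s: "r = True # s" "find_clause C \<chi> = Some s" by auto
    then show ?thesis
      using 2(2)[OF None s(2)] by (auto simp: all_prefix_Cons free_at_simps)
  next
    case (Some s)
    with 2(3) have r: "r = False # s" by simp
    show ?thesis
      unfolding r using 2(1)[OF Some] by (auto simp: all_prefix_Cons free_at_simps)
  qed
next
  case (3 C v \<phi>)
  then obtain s where s: "r = False # s" "find_clause C \<phi> = Some s" "v \<notin> vars C"
    by (auto split: if_splits)
  then show ?case
    using 3(1)[OF s(3,2)] by (auto simp: all_prefix_Cons free_at_simps)
next
  case (4 C v \<phi>)
  then obtain s where s: "r = False # s" "find_clause C \<phi> = Some s" "v \<notin> vars C"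
    by (auto split: if_splits)
  then show ?case
    using 4(1)[OF s(3,2)] by (auto simp: all_prefix_Cons free_at_simps)
qed

text \<open>\<open>r\<close> only witnesses success: the search prefers first conjuncts and may
  return another path. A quantification on \<open>r\<close> that binds a variable of
  \<open>C\<close> would contradict freeness at that very index, so the search is not blocked along
  \<open>r\<close>.\<close>

lemma find_clause_complete:
  "subf \<phi> r = Some (Clause C) \<Longrightarrow> (\<And>k. prefix k r \<Longrightarrow> vars C \<subseteq> free_at \<phi> k) \<Longrightarrow>
     find_clause C \<phi> \<noteq> None"
proof (induction C \<phi> arbitrary: r rule: find_clause.induct)
  case (1 C \<alpha>)
  then show ?case by (cases r) auto
next
  case (2 C \<phi> \<chi>)
  then obtain d s where r: "r = d # s" by (cases r) auto
  have "vars C \<subseteq> free_at (if d then \<chi> else \<phi>) k" if "prefix k s" for k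
    using 2(4)[of "d # k"] that r by (simp add: free_at_def)
  then show ?case
    using 2(1,2)[of s] 2(3) r by (auto split: option.splits if_splits)
next
  case (3 C v \<phi>)
  then obtain s where r: "r = False # s"
    by (cases r) (auto simp: subf_Forall_Cons split: if_splits)
  have "vars C \<subseteq> free_at \<phi> k" if "prefix k s" for k
    using 3(3)[of "False # k"] that r by (simp add: free_at_def)
  moreover have "v \<notin> vars C"
    using 3(3)[of "[]"] by (auto simp: free_at_def)
  ultimately show ?case
    using 3(1)[of s] 3(2) r by auto
next
  case (4 C v \<phi>)
  then obtain s where r: "r = False # s"
    by (cases r) (auto simp: subf_Exists_Cons split: if_splits)
  have "vars C \<subseteq> free_at \<phi> k" if "prefix k s" for k
    using 4(3)[of "False # k"] that r by (simp add: free_at_def)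
  moreover have "v \<notin> vars C"
    using 4(3)[of "[]"] by (auto simp: free_at_def)
  ultimately show ?case
    using 4(1)[of s] 4(2) r by auto
qed

section \<open>Finiteness, and the geometry of coherent sets\<close>

lemma finite_indices: "finite (indices \<psi>)"
proof (induction \<psi>)
  case (Clause \<alpha>)
  have "indices (Clause \<alpha>) \<subseteq> {[]}"
    by (auto simp: indices_def elim: subf.elims)
  then show ?case
    by (rule finite_subset) simp
next
  case (And \<phi> \<chi>)
  have "i \<in> {[]} \<union> Cons False ` indices \<phi> \<union> Cons True ` indices \<chi>"
    if "i \<in> indices (And \<phi> \<chi>)" for i
    using that by (cases i) (auto simp: indices_def split: if_splits)
  then have "indices (And \<phi> \<chi>) \<subseteq> {[]} \<union> Cons False ` indices \<phi> \<union> Cons True ` indices \<chi>"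
    by blast
  then show ?case
    by (rule finite_subset) (simp add: And)
next
  case (Forall v \<phi>)
  have "i \<in> {[]} \<union> Cons False ` indices \<phi>" if "i \<in> indices (Forall v \<phi>)" for i
    using that by (cases i) (auto simp: indices_def subf_Forall_Cons split: if_splits)
  then have "indices (Forall v \<phi>) \<subseteq> {[]} \<union> Cons False ` indices \<phi>"
    by blast
  then show ?case
    by (rule finite_subset) (simp add: Forall)
next
  case (Exists v \<phi>)
  have "i \<in> {[]} \<union> Cons False ` indices \<phi>" if "i \<in> indices (Exists v \<phi>)" for i
    using that by (cases i) (auto simp: indices_def subf_Exists_Cons split: if_splits)
  then have "indices (Exists v \<phi>) \<subseteq> {[]} \<union> Cons False ` indices \<phi>"
    by blast
  then show ?case
    by (rule finite_subset) (simp add: Exists)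
qed

lemma located_indices: "located \<psi> p \<Longrightarrow> fst p \<in> indices \<psi>"
  by (auto simp: located_def forall_located_def exists_located_def indices_def)

lemma located_unique: "located \<psi> (i, u) \<Longrightarrow> located \<psi> (i, v) \<Longrightarrow> u = v"
  by (auto simp: located_def forall_located_def exists_located_def)

lemma finite_located: "finite {p. located \<psi> p}"
proof (rule inj_on_finite)
  show "inj_on fst {p. located \<psi> p}"
    by (auto simp: inj_on_def dest: located_unique)
  show "fst ` {p. located \<psi> p} \<subseteq> indices \<psi>"
    by (auto dest: located_indices)
qed (rule finite_indices)

text \<open>Labels carry no finiteness condition. It comes from the syntax tree, which has finitely
  many indices with at most one quantified variable each; \<open>Max\<close> and the encoding by
  sorted lists rely on it.\<close>

lemma label_ok_finite: "label_ok \<psi> S a \<Longrightarrow> finite S"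
  by (rule finite_subset[OF _ finite_located]) (auto simp: label_ok_def)

lemma label_ok_finite_dom: "label_ok \<psi> S a \<Longrightarrow> finite (dom a)"
  using label_ok_finite[of \<psi> S a] by (simp add: label_ok_def lvars_def)

lemma located_body_indices: "located \<psi> p \<Longrightarrow> fst p @ [False] \<in> indices \<psi>"
  by (auto simp: located_def forall_located_def exists_located_def indices_def subf_append)

text \<open>Used in two ways: a variable is never free at its own quantification, and whatever is
  free at a quantification is still free in its body.\<close>

lemma located_free_at:
  "located \<psi> p \<Longrightarrow> free_at \<psi> (fst p) = free_at \<psi> (fst p @ [False]) - {snd p}"
  by (auto simp: located_def forall_located_def exists_located_def free_at_def subf_append)

lemma located_strict_prefix:
  assumes "located \<psi> p" "strict_prefix (fst p) k" "k \<in> indices \<psi>"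
  shows "prefix (fst p @ [False]) k"
proof -
  obtain d r where k: "k = fst p @ d # r"
    using assms(2) by (elim strict_prefixE')
  then have "\<not> d"
    using assms(1,3) by (auto simp: located_def forall_located_def exists_located_def indices_def
        subf_append subf_Forall_Cons subf_Exists_Cons split: if_splits)
  then show ?thesis
    using k by (simp add: prefix_def)
qed

lemma follows_free_at:
  assumes "follows \<psi> i p"
  shows "snd p \<in> free_at \<psi> i"
  using assms by (auto simp: follows_def)

lemma strict_prefix_imp_less:
  fixes i j :: index
  assumes "strict_prefix i j"
  shows "i < j"
proof -
  obtain d r where "j = i @ d # r"
    using assms by (elim strict_prefixE')
  then show ?thesis
    by (simp add: list_less_def lexord_append_rightI)
qed

text \<open>Following entails a strict prefix and hence a strictly greater location in the
  lexicographic order, so of the two directions that coherence offers only this one is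
  possible.\<close>

lemma Max_follows:
  assumes "finite S" "coherent \<psi> S" "p \<in> S" "p \<noteq> Max S"
  shows "follows \<psi> (fst (Max S)) p"
proof -
  have "Max S \<in> S" "p \<le> Max S"
    using assms by (auto intro: Max_in)
  moreover have "\<not> follows \<psi> (fst p) (Max S)"
  proof
    assume "follows \<psi> (fst p) (Max S)"
    then have "fst (Max S) < fst p"
      by (simp add: follows_def strict_prefix_imp_less)
    then show False
      using \<open>p \<le> Max S\<close> by (auto simp: less_eq_prod_def)
  qed
  ultimately show ?thesis
    using assms by (auto simp: coherent_def)
qed

text \<open>All locations of \<open>S\<close> are prefixes of the innermost one, so an index at or
  below its body lies strictly below every location. Since \<open>x\<close> follows
  \<open>S\<close>, the variables are free at all such indices up to \<open>x\<close>.\<close>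

lemma follows_set_body_loc:
  assumes S: "\<forall>p\<in>S. located \<psi> p" "finite S" "coherent \<psi> S" and x: "follows_set \<psi> x S"
  shows "prefix (body_loc S) x"
    and "prefix (body_loc S) k \<Longrightarrow> prefix k x \<Longrightarrow> k \<in> indices \<psi> \<and> lvars S \<subseteq> free_at \<psi> k"
proof -
  have ind: "x \<in> indices \<psi>"
    using x by (simp add: follows_set_def)
  have *: "strict_prefix (loc S) x \<and> prefix (body_loc S) x" if "S \<noteq> {}"
  proof -
    have "Max S \<in> S"
      using S(2) that by (rule Max_in)
    then show ?thesis
      using S(1) x that located_strict_prefix[of \<psi> "Max S" x]
      by (auto simp: follows_set_def follows_def body_loc_def loc_def)
  qed
  then show "prefix (body_loc S) x"
    by (cases "S = {}") (auto simp: body_loc_def)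
  assume k: "prefix (body_loc S) k" "prefix k x"
  have "snd p \<in> free_at \<psi> k" if p: "p \<in> S" for p
  proof -
    have "prefix (fst p) (loc S)"
      using Max_follows[OF S(2,3) p] p by (cases "p = Max S") (auto simp: loc_def follows_def)
    moreover have "strict_prefix (loc S) k"
    proof -
      have "prefix (loc S @ [False]) k"
        using k(1) p by (cases "S = {}") (simp_all add: body_loc_def)
      then show ?thesis
        by (auto simp: prefix_def strict_prefix_def)
    qed
    ultimately have "strict_prefix (fst p) k"
      by (rule prefix_order.le_less_trans)
    then show ?thesis
      using x p k by (auto simp: follows_set_def follows_def)
  qed
  then show "k \<in> indices \<psi> \<and> lvars S \<subseteq> free_at \<psi> k"
    using indices_prefix[OF ind k(2)] by (auto simp: lvars_def)
qed

text \<open>A subset either keeps the innermost element, and then has the same body, or loses it. In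
  the latter case coherence makes the location of the lost element follow the subset, which brings
  \<open>follows_set_body_loc\<close> into play.\<close>

lemma body_loc_subset_cases:
  assumes B: "\<forall>p\<in>B. located \<psi> p" "finite B" "coherent \<psi> B" and AB: "A \<subseteq> B"
  obtains "body_loc A = body_loc B"
  | "body_loc B = loc B @ [False]" "follows_set \<psi> (loc B) A" "B \<noteq> {}" "Max B \<notin> A"
proof (cases "B = {} \<or> Max B \<in> A")
  case True
  have "body_loc A = body_loc B"
  proof (cases "B = {}")
    case False
    then have "Max B \<in> A"
      using True by simp
    moreover from this have "Max A = Max B"
      using AB B(2) by (meson Max.coboundedI Max_eqI finite_subset subsetD)
    ultimately show ?thesis
      using False by (auto simp: body_loc_def loc_def)
  qed (use AB in auto)
  then show ?thesis by (rule that)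
next
  case False
  then have "Max B \<in> B"
    using B(2) by auto
  then have "fst (Max B) \<in> indices \<psi>"
    using B(1) located_indices by blast
  moreover have "follows \<psi> (fst (Max B)) p" if "p \<in> A" for p
    using that False AB by (intro Max_follows[OF B(2,3)]) auto
  ultimately have "follows_set \<psi> (loc B) A"
    using False by (simp add: follows_set_def loc_def)
  then show ?thesis
    using False by (intro that(2)) (auto simp: body_loc_def)
qed

text \<open>The side condition excludes the endpoint when both bodies coincide: there the innermost
  variable belongs to \<open>A\<close>, and its freeness in the body does not follow from coherence.
  If the bodies differ, the endpoint is one step below \<open>loc B\<close>, and that step only
  releases the variable of \<open>Max B\<close>.\<close>

lemma body_loc_subset:
  assumes B: "\<forall>p\<in>B. located \<psi> p" "finite B" "coherent \<psi> B" and AB: "A \<subseteq> B"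
  shows "prefix (body_loc A) (body_loc B)"
    and "prefix (body_loc A) k \<Longrightarrow> prefix k (body_loc B) \<Longrightarrow>
      k \<noteq> body_loc B \<or> body_loc A \<noteq> body_loc B \<Longrightarrow> k \<in> indices \<psi> \<and> lvars A \<subseteq> free_at \<psi> k"
proof -
  have A: "\<forall>p\<in>A. located \<psi> p" "finite A" "coherent \<psi> A"
    using B AB unfolding coherent_def by (blast intro: finite_subset)+
  show "prefix (body_loc A) (body_loc B)"
  proof (cases rule: body_loc_subset_cases[OF B AB])
    case 2
    then show ?thesis
      using follows_set_body_loc(1)[OF A 2(2)] by simp
  qed simp
  assume k: "prefix (body_loc A) k" "prefix k (body_loc B)"
    "k \<noteq> body_loc B \<or> body_loc A \<noteq> body_loc B"
  show "k \<in> indices \<psi> \<and> lvars A \<subseteq> free_at \<psi> k"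
  proof (cases rule: body_loc_subset_cases[OF B AB])
    case 1
    then show ?thesis
      using k by (auto dest: prefix_order.antisym)
  next
    case 2
    show ?thesis
    proof (cases "k = body_loc B")
      case False
      then have "prefix k (loc B)"
        using k(2) 2(1) by simp
      then show ?thesis
        using follows_set_body_loc(2)[OF A 2(2) k(1)] by simp
    next
      case True
      have m: "located \<psi> (Max B)" "loc B = fst (Max B)"
        using B 2(3) by (auto simp: loc_def)
      have "lvars A \<subseteq> free_at \<psi> (loc B)"
        using 2(2) by (auto simp: lvars_def follows_set_def dest: follows_free_at)
      then show ?thesis
        using located_free_at[OF m(1)] located_body_indices[OF m(1)] m(2) True 2(1) by auto
    qed
  qed
qed

lemma prefix_append_drop: "prefix i j \<Longrightarrow> i @ drop (length i) j = j"
  by (auto simp: prefix_def)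

text \<open>The maximum of the union lies in \<open>A\<close> or in \<open>B\<close>, so one of the
  two bodies is already that of the union and the other is a prefix of it. Comparing lengths
  therefore finds the location at which to resolve.\<close>

lemma body_loc_Un:
  assumes B: "\<forall>p\<in>A \<union> B. located \<psi> p" "finite (A \<union> B)" "coherent \<psi> (A \<union> B)"
  shows "body_loc (A \<union> B) = longer (body_loc A) (body_loc B)"
proof -
  have pre: "prefix (body_loc A) (body_loc (A \<union> B))" "prefix (body_loc B) (body_loc (A \<union> B))"
    using body_loc_subset(1)[OF B] by auto
  have "body_loc A = body_loc (A \<union> B) \<or> body_loc B = body_loc (A \<union> B)"
  proof (cases rule: body_loc_subset_cases[OF B Un_upper1[of A B]])
    case A: 2
    show ?thesis
    proof (cases rule: body_loc_subset_cases[OF B Un_upper2[of B A]])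
      case 2
      then show ?thesis
        using A Max_in[OF B(2)] by auto
    qed simp
  qed simp
  then show ?thesis
    using pre by (auto simp: longer_def dest: prefix_length_le)
      (metis append_take_drop_id append.right_neutral drop_all prefix_append_drop)
qed

section \<open>Correctness of the translation\<close>

lemma is_trace_label_ok: "is_trace \<psi> t \<Longrightarrow> label t = (S, a) \<Longrightarrow> label_ok \<psi> S a"
  by (erule is_trace.cases) auto

lemma is_judgement_falsified_clause:
  assumes "label_ok \<psi> S a" "k \<in> indices \<psi>" "lvars S \<subseteq> free_at \<psi> k"
  shows "is_judgement \<psi> (k, falsified_clause a)"
  using assms label_ok_finite_dom[OF assms(1)]
  by (simp add: is_judgement_def is_clause_falsified_clause vars_falsified_clause label_ok_def)

lemma forall_located_located: "forall_located \<psi> p \<Longrightarrow> located \<psi> p"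
  by (simp add: located_def)

lemma follows_set_not_in_lvars:
  assumes "located \<psi> (i, u)" "follows_set \<psi> i S"
  shows "u \<notin> lvars S"
  using assms located_free_at[OF assms(1)]
  by (auto simp: lvars_def follows_set_def dest: follows_free_at)

text \<open>Of two locations that quantify the same variable neither can follow the other, since the
  variable is not free at its own quantification. This makes the pivot of a resolution fresh for the
  label.\<close>

lemma coherent_not_in_lvars:
  assumes "\<forall>p\<in>insert (i, u) S. located \<psi> p" "coherent \<psi> (insert (i, u) S)" "(i, u) \<notin> S"
  shows "u \<notin> lvars S"
proof
  assume "u \<in> lvars S"
  then obtain j where j: "(j, u) \<in> S"
    by (auto simp: lvars_def)
  then have "follows \<psi> i (j, u) \<or> follows \<psi> j (i, u)"
    using assms(2,3) unfolding coherent_def by (metis fst_conv insert_iff)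
  moreover have "u \<notin> free_at \<psi> i" "u \<notin> free_at \<psi> j"
    using located_free_at[of \<psi> "(i, u)"] located_free_at[of \<psi> "(j, u)"] assms(1) j by auto
  ultimately show False
    by (auto dest: follows_free_at)
qed

lemma falsified_clause_restrict:
  "falsified_clause (a |` X) = {L \<in> falsified_clause a. fst L \<in> X}"
  by (auto simp: mem_falsified_clause restrict_map_def split: if_splits)

lemma falsified_clause_upd:
  "u \<notin> dom a \<Longrightarrow> falsified_clause (a(u \<mapsto> b)) = insert (u, \<not> b) (falsified_clause a)"
  by (auto simp: mem_falsified_clause split: if_splits)

lemma falsified_clause_fst: "L \<in> falsified_clause a \<Longrightarrow> fst L \<in> dom a"
  by (metis dom_def imageI vars_def vars_falsified_clause)

text \<open>The index \<open>i\<close> of the leaf guarantees that the search succeeds; afterwards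
  only the occurrence found matters, and soundness of the search supplies the judgements on the way
  to it.\<close>

lemma leaf_path_correct:
  assumes "label_ok \<psi> S a" "follows_set \<psi> i S" "subf \<psi> i = Some (Clause \<alpha>)"
    and "falsified \<alpha> a" "vars \<alpha> = lvars S"
  defines "j \<equiv> body_loc S" and "C \<equiv> falsified_clause a"
  shows "\<exists>\<phi>. subf \<psi> j = Some \<phi> \<and> find_clause C \<phi> = Some (leaf_path \<psi> j C)"
    and "subf \<psi> (j @ leaf_path \<psi> j C) = Some (Clause C)"
    and "prefix k (leaf_path \<psi> j C) \<Longrightarrow> is_judgement \<psi> (j @ k, C)"
proof -
  have S: "\<forall>p\<in>S. located \<psi> p" "finite S" "coherent \<psi> S"
    using assms(1) label_ok_finite by (auto simp: label_ok_def)
  have C: "C = \<alpha>"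
    using falsified_imp_eq_falsified_clause[OF assms(4)] assms(1,5)
    by (simp add: label_ok_def C_def)
  note pre = follows_set_body_loc[OF S assms(2), folded j_def]
  obtain r where r: "i = j @ r"
    using pre(1) by (auto simp: prefix_def)
  obtain \<phi> where \<phi>: "subf \<psi> j = Some \<phi>" "subf \<phi> r = Some (Clause C)"
    using assms(3) r C by (auto simp: subf_append bind_eq_Some_conv)
  have free: "free_at \<psi> (j @ k) = free_at \<phi> k" for k
    using \<phi> by (simp add: free_at_def subf_append)
  have "find_clause C \<phi> \<noteq> None"
  proof (rule find_clause_complete[OF \<phi>(2)])
    fix k
    assume "prefix k r"
    then show "vars C \<subseteq> free_at \<phi> k"
      using pre(2)[of "j @ k"] r assms(5) C free[of k] by simp
  qed
  then have find: "find_clause C \<phi> = Some (leaf_path \<psi> j C)"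
    using \<phi>(1) by (simp add: leaf_path_def)
  then show "\<exists>\<phi>. subf \<psi> j = Some \<phi> \<and> find_clause C \<phi> = Some (leaf_path \<psi> j C)"
    using \<phi>(1) by blast
  note sound = find_clause_sound[OF find]
  show sub: "subf \<psi> (j @ leaf_path \<psi> j C) = Some (Clause C)"
    using sound \<phi>(1) by (simp add: subf_append)
  assume "prefix k (leaf_path \<psi> j C)"
  then show "is_judgement \<psi> (j @ k, C)"
    using sound assms(5) C sub free[of k]
      is_judgement_falsified_clause[OF assms(1), of "j @ k"]
      indices_prefix[of "j @ leaf_path \<psi> j C" \<psi> "j @ k"]
    by (auto simp: C_def indices_def)
qed

lemma translate_correct:
  assumes "is_trace \<psi> t"
  shows "valid \<psi> (translate \<psi> t) \<and> root (translate \<psi> t) = (body_loc (trace_set t), trace_clause t) \<and>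
    non_flow (translate \<psi> t) = nodes t"
  using assms
proof (induction rule: is_trace.induct)
  case (leaf S a i \<alpha>)
  note path = leaf_path_correct[OF leaf]
  show ?case
    using up_chain_valid[of \<psi> "PTree (body_loc S @ leaf_path \<psi> (body_loc S) (falsified_clause a),
        falsified_clause a) By_Clause" "body_loc S" "leaf_path \<psi> (body_loc S) (falsified_clause a)"
        "falsified_clause a"] path
    by (auto simp: leaf_tree_def)
next
  case (one S a t i y b)
  have S: "\<forall>p\<in>S. located \<psi> p" "finite S" "coherent \<psi> S" and dom: "dom a = lvars S"
    using one.hyps label_ok_finite by (auto simp: label_ok_def)
  note loc = forall_located_located[OF one.hyps(3)]
  have y: "y \<notin> lvars S"
    using follows_set_not_in_lvars[OF loc one.hyps(4)] .
  \<comment> \<open>Since \<open>i\<close> follows \<open>S\<close>, every other location is a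
    strict prefix of \<open>i\<close>. Hence the clause of the child sits at
    \<open>i @ [False]\<close>, exactly the child index that the removal at \<open>i\<close>
    expects.\<close>
  have "Max (S \<union> {(i, y)}) = (i, y)"
  proof (rule Max_eqI)
    show "p \<le> (i, y)" if "p \<in> S \<union> {(i, y)}" for p
    proof (cases "p = (i, y)")
      case False
      then have "fst p < i"
        using that one.hyps(4) by (auto simp: follows_set_def follows_def intro: strict_prefix_imp_less)
      then show ?thesis
        by (cases p) (simp add: less_eq_prod_def)
    qed simp
  qed (use S in auto)
  then have i: "loc (trace_set t) = i" "body_loc (trace_set t) = i @ [False]"
    by (simp_all add: one.hyps loc_def body_loc_def)
  \<comment> \<open>\<open>y\<close> lies outside the domain of \<open>a\<close>, so deleting its
    literals undoes precisely the extension made in the child.\<close>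
  have removed: "falsified_clause a = trace_clause t - {(y, True), (y, False)}"
    using y by (auto simp: one.hyps mem_falsified_clause dom[symmetric] dom_def)
  note pre = follows_set_body_loc[OF S one.hyps(4)]
  have judge: "is_judgement \<psi> (k, falsified_clause a)"
    if "prefix (body_loc S) k" "prefix k i" for k
    using pre(2)[OF that] by (intro is_judgement_falsified_clause[OF one.hyps(1)]) auto
  have "\<exists>\<phi>. subf \<psi> i = Some (Forall y \<phi>)"
    using one.hyps(3) by (simp add: forall_located_def)
  then have "valid \<psi> (PTree (i, falsified_clause a) (Forall_Removal (translate \<psi> t)))"
    using one.IH judge[of i] pre(1) removed i by (auto simp: parent_def)
  moreover have "is_judgement \<psi> (body_loc S @ k, falsified_clause a)"
    if "strict_prefix k (drop (length (body_loc S)) i)" for k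
    using that pre(1) by (intro judge) (auto simp: prefix_def strict_prefix_def)
  ultimately show ?case
    using up_chain_valid[of \<psi> "PTree (i, falsified_clause a) (Forall_Removal (translate \<psi> t))"
        "body_loc S" "drop (length (body_loc S)) i" "falsified_clause a"]
      one.IH i prefix_append_drop[OF pre(1)]
    by (auto simp: removal_tree_def)
next
  case (two S a t0 t1 i u S0 S1 ts)
  define B where "B = S \<union> {(i, u)}"
  have B: "\<forall>p\<in>B. located \<psi> p" "finite B" "coherent \<psi> B" and dom: "dom a = lvars S"
    using two.hyps label_ok_finite[OF two.hyps(1)] by (auto simp: B_def label_ok_def)
  have u: "u \<notin> lvars S"
    using coherent_not_in_lvars[of i u S \<psi>] B two.hyps by (auto simp: B_def)
  have finite: "finite (dom a)"
    using label_ok_finite_dom[OF two.hyps(1)] .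
  \<comment> \<open>Stated for an arbitrary sign \<open>b\<close>, so that both listings of the two
    children are instances.\<close>
  have main: "valid \<psi> (translate \<psi> (TNode S a [t, t'])) \<and>
    root (translate \<psi> (TNode S a [t, t'])) = (body_loc S, falsified_clause a) \<and>
    non_flow (translate \<psi> (TNode S a [t, t'])) = Suc (nodes t + nodes t')"
    if t: "is_trace \<psi> t" "label t = (S' \<union> {(i, u)}, (a |` lvars S')(u \<mapsto> b))"
        "valid \<psi> (translate \<psi> t) \<and> root (translate \<psi> t) = (body_loc (trace_set t), trace_clause t) \<and>
          non_flow (translate \<psi> t) = nodes t"
      and t': "is_trace \<psi> t'" "label t' = (S'' \<union> {(i, u)}, (a |` lvars S'')(u \<mapsto> \<not> b))"
        "valid \<psi> (translate \<psi> t') \<and> root (translate \<psi> t') = (body_loc (trace_set t'), trace_clause t') \<and>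
          non_flow (translate \<psi> t') = nodes t'"
      and S: "S' \<union> S'' = S" for t t' S' S'' b
  proof -
    define j where "j = body_loc B"
    have Un: "trace_set t \<union> trace_set t' = B"
      using S by (auto simp: t t' B_def)
    then have j: "longer (body_loc (trace_set t)) (body_loc (trace_set t')) = j"
      using body_loc_Un[of "trace_set t" "trace_set t'" \<psi>] B by (simp add: j_def)
    have lower: "valid \<psi> (lower (body_loc (trace_set w)) j (trace_clause w) (translate \<psi> w)) \<and>
        root (lower (body_loc (trace_set w)) j (trace_clause w) (translate \<psi> w)) = (j, trace_clause w) \<and>
        non_flow (lower (body_loc (trace_set w)) j (trace_clause w) (translate \<psi> w)) = nodes w"
      if w: "is_trace \<psi> w" "trace_set w \<subseteq> B" "valid \<psi> (translate \<psi> w) \<and>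
          root (translate \<psi> w) = (body_loc (trace_set w), trace_clause w) \<and>
          non_flow (translate \<psi> w) = nodes w" for w
    proof -
      have ok: "label_ok \<psi> (trace_set w) (snd (label w))"
        using is_trace_label_ok[OF w(1)] by (metis prod.collapse)
      note sub = body_loc_subset[OF B w(2), folded j_def]
      have "is_judgement \<psi> (body_loc (trace_set w) @ k, trace_clause w)"
        if "prefix k (drop (length (body_loc (trace_set w))) j)" for k
      proof (cases "body_loc (trace_set w) = j")
        \<comment> \<open>This is the endpoint excluded in \<open>body_loc_subset\<close>. Here
          \<open>k\<close> is empty, and the judgement is the root of the child derivation, which is
          valid.\<close>
        case True
        then show ?thesis
          using that w(3) valid_is_judgement[of \<psi> "translate \<psi> w"] by simp
      next
        case False
        moreover have "prefix (body_loc (trace_set w) @ k) j"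
          using that sub(1) by (auto simp: prefix_def)
        ultimately show ?thesis
          using sub(2)[of "body_loc (trace_set w) @ k"]
          by (intro is_judgement_falsified_clause[OF ok]) auto
      qed
      then show ?thesis
        using down_chain_valid[of \<psi> "translate \<psi> w" "body_loc (trace_set w)" "trace_clause w"
            "drop (length (body_loc (trace_set w))) j"] w(3) prefix_append_drop[OF sub(1)]
        by (simp add: lower_def)
    qed
    have low: "trace_set t \<subseteq> B" "trace_set t' \<subseteq> B"
      using Un by auto
    note lt = lower[OF t(1) low(1) t(3)] and lt' = lower[OF t'(1) low(2) t'(3)]
    have cl: "trace_clause t = insert (u, \<not> b) {L \<in> falsified_clause a. fst L \<in> lvars S'}"
      "trace_clause t' = insert (u, b) {L \<in> falsified_clause a. fst L \<in> lvars S''}"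
      using u dom by (simp_all add: t t' falsified_clause_upd falsified_clause_restrict)
    have notin: "L \<in> falsified_clause a \<Longrightarrow> fst L \<noteq> u" for L
      using u dom falsified_clause_fst by fastforce
    have all: "L \<in> falsified_clause a \<Longrightarrow> fst L \<in> lvars S' \<or> fst L \<in> lvars S''" for L
      using falsified_clause_fst[of L a] dom S by (auto simp: lvars_def)
    have "falsified_clause a = trace_clause t - {(u, \<not> b)} \<union> (trace_clause t' - {(u, b)})"
      unfolding cl using notin all by fastforce
    then have res: "resolvent (trace_clause t) (trace_clause t') (falsified_clause a)"
      unfolding resolvent_def using is_clause_falsified_clause[OF finite] cl
      by (auto simp: compl_def intro!: bexI[of _ "(u, \<not> b)"])
    have "S \<subseteq> B"
      by (auto simp: B_def)
    note sub = body_loc_subset[OF B this, folded j_def]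
    have judge: "is_judgement \<psi> (body_loc S @ k, falsified_clause a)"
      if "strict_prefix k (drop (length (body_loc S)) j)" for k
    proof -
      have "prefix (body_loc S @ k) j" "body_loc S @ k \<noteq> j"
        using that sub(1) by (auto simp: prefix_def strict_prefix_def)
      then show ?thesis
        using sub(2)[of "body_loc S @ k"]
        by (intro is_judgement_falsified_clause[OF two.hyps(1)]) auto
    qed
    \<comment> \<open>At \<open>j\<close> geometry may give nothing. Both lowered clauses are
      judgements there, however, and together they mention all variables of
      \<open>S\<close>.\<close>
    have "is_judgement \<psi> (j, falsified_clause a)"
    proof (rule is_judgement_falsified_clause[OF two.hyps(1)])
      have "is_judgement \<psi> (j, trace_clause t)" "is_judgement \<psi> (j, trace_clause t')"
        using lt lt' valid_is_judgement by metis+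
      then have "j \<in> indices \<psi>" "dom (snd (label t)) \<subseteq> free_at \<psi> j" "dom (snd (label t')) \<subseteq> free_at \<psi> j"
        by (simp_all add: is_judgement_def vars_falsified_clause)
      moreover have "lvars S \<subseteq> dom (snd (label t)) \<union> dom (snd (label t'))"
        using S dom by (auto simp: t t' lvars_def)
      ultimately show "j \<in> indices \<psi>" "lvars S \<subseteq> free_at \<psi> j"
        by blast+
    qed
    then have "valid \<psi> (PTree (j, falsified_clause a)
        (Resolve (lower (body_loc (trace_set t)) j (trace_clause t) (translate \<psi> t))
          (lower (body_loc (trace_set t')) j (trace_clause t') (translate \<psi> t'))))"
      using lt lt' res by simp
    then show ?thesis
      using up_chain_valid[OF _ _ judge] prefix_append_drop[OF sub(1)] lt lt' j
      by (simp add: Let_def resolution_tree_def)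
  qed
  from two.hyps(12) show ?case
  proof
    assume "ts = [t0, t1]"
    then show ?thesis
      using main[OF two.hyps(2) two.hyps(10) two.IH(1) two.hyps(3) _ two.IH(2)] two.hyps by simp
  next
    assume "ts = [t1, t0]"
    then show ?thesis
      using main[OF two.hyps(3) two.hyps(11) two.IH(2) two.hyps(2) _ two.IH(1)] two.hyps by auto
  qed
qed

lemma translate_empty_clause_proof:
  assumes "is_trace \<psi> T" "label T = ({}, Map.empty)"
  shows "tree_like_empty_clause_proof \<psi> (translate \<psi> T) \<and> non_flow (translate \<psi> T) = nodes T"
  using translate_correct[OF assms(1)] assms(2)
  by (auto simp: falsified_clause_def intro!: valid_tree_like_empty_clause_proof)

section \<open>Counting evaluation steps\<close>

text \<open>If all values have size at most \<open>M\<close>, then \<open>k\<close> evaluation steps take time at most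
  \<open>k * M\<close>. So it suffices to count the steps and to bound the sizes.\<close>

definition bounded_eval :: "program \<Rightarrow> nat \<Rightarrow> data list \<Rightarrow> expr \<Rightarrow> data \<Rightarrow> nat \<Rightarrow> bool" where
  "bounded_eval P M xs e v k \<longleftrightarrow> dsize v \<le> M \<and> (\<exists>t\<le>k * M. eval P xs e v t)"

text \<open>Determinism makes the value unique, and taking the least step count makes the pair a
  function of the arguments. Facts about \<open>call\<close> can then be used as equations when a
  body is evaluated.\<close>

definition call :: "program \<Rightarrow> nat \<Rightarrow> nat \<Rightarrow> data list \<Rightarrow> (data \<times> nat) option" where
  "call P M f vs =
     (if f < length P \<and> (\<exists>v k. bounded_eval P M vs (P ! f) v k)
      then Some (THE v. \<exists>k. bounded_eval P M vs (P ! f) v k,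
        LEAST k. \<exists>v. bounded_eval P M vs (P ! f) v k)
      else None)"

text \<open>Resolving calls by \<^const>\<open>call\<close> makes the recursion structural although programs need not
  terminate. Only \<^const>\<open>EDot\<close> can yield a value larger than all previous values, so only its
  size is checked.\<close>

fun run :: "program \<Rightarrow> nat \<Rightarrow> data list \<Rightarrow> expr \<Rightarrow> (data \<times> nat) option"
  and run_list :: "program \<Rightarrow> nat \<Rightarrow> data list \<Rightarrow> expr list \<Rightarrow> (data list \<times> nat) option" where
  "run P M xs (EArg n) = (if n < length xs then Some (xs ! n, 1) else None)"
| "run P M xs EAtom = Some (Atom, 1)"
| "run P M xs (EDot e1 e2) =
     (case run P M xs e1 of None \<Rightarrow> None | Some (v1, k1) \<Rightarrow>
     (case run P M xs e2 of None \<Rightarrow> None | Some (v2, k2) \<Rightarrow>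
     (if dsize (Dot v1 v2) \<le> M then Some (Dot v1 v2, k1 + k2 + 1) else None)))"
| "run P M xs (EFst e) =
     (case run P M xs e of None \<Rightarrow> None | Some (v, k) \<Rightarrow> Some (dfst v, k + 1))"
| "run P M xs (ESnd e) =
     (case run P M xs e of None \<Rightarrow> None | Some (v, k) \<Rightarrow> Some (dsnd v, k + 1))"
| "run P M xs (EEq e1 e2) =
     (case run P M xs e1 of None \<Rightarrow> None | Some (v1, k1) \<Rightarrow>
     (case run P M xs e2 of None \<Rightarrow> None | Some (v2, k2) \<Rightarrow>
     Some (enc_bool (v1 = v2), k1 + k2 + 1)))"
| "run P M xs (EIf e e1 e2) =
     (case run P M xs e of None \<Rightarrow> None | Some (v, k) \<Rightarrow>
     (case (if v = Atom then run P M xs e2 else run P M xs e1) of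
        None \<Rightarrow> None
      | Some (v', k') \<Rightarrow> Some (v', k + k' + 1)))"
| "run P M xs (ECall f es) =
     (case run_list P M xs es of None \<Rightarrow> None | Some (vs, k) \<Rightarrow>
     (case call P M f vs of None \<Rightarrow> None | Some (v, k') \<Rightarrow> Some (v, k + k' + 1)))"
| "run_list P M xs [] = Some ([], 0)"
| "run_list P M xs (e # es) =
     (case run P M xs e of None \<Rightarrow> None | Some (v, k) \<Rightarrow>
     (case run_list P M xs es of None \<Rightarrow> None | Some (vs, k') \<Rightarrow> Some (v # vs, k + k')))"

lemma call_SomeI:
  assumes "f < length P" "bounded_eval P M vs (P ! f) v k"
  shows "\<exists>k'\<le>k. call P M f vs = Some (v, k')"
proof -
  have unique: "v' = v" if "bounded_eval P M vs (P ! f) v' k'" for v' k'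
    using assms(2) that by (auto simp: bounded_eval_def dest: eval_deterministic)
  have "(THE v. \<exists>k. bounded_eval P M vs (P ! f) v k) = v"
    using assms(2) unique by blast
  moreover have "(LEAST k. \<exists>v. bounded_eval P M vs (P ! f) v k) \<le> k"
    using assms(2) by (intro Least_le) blast
  ultimately show ?thesis
    using assms by (auto simp: call_def)
qed

lemma call_SomeD:
  assumes "call P M f vs = Some (v, k)"
  shows "f < length P" "bounded_eval P M vs (P ! f) v k"
proof -
  show f: "f < length P"
    using assms by (simp add: call_def split: if_splits)
  obtain v' k' where e: "bounded_eval P M vs (P ! f) v' k'"
    using assms by (auto simp: call_def split: if_splits)
  have unique: "w = v'" if "bounded_eval P M vs (P ! f) w l" for w l
    using e that by (auto simp: bounded_eval_def dest: eval_deterministic)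
  have "(THE v. \<exists>k. bounded_eval P M vs (P ! f) v k) = v'"
    using e unique by blast
  then have v: "v = v'" and k: "k = (LEAST k. \<exists>v. bounded_eval P M vs (P ! f) v k)"
    using assms by (simp_all add: call_def split: if_splits)
  have "\<exists>v. bounded_eval P M vs (P ! f) v k"
    unfolding k by (rule LeastI[of "\<lambda>k. \<exists>v. bounded_eval P M vs (P ! f) v k" k']) (use e in blast)
  then show "bounded_eval P M vs (P ! f) v k"
    using unique v by blast
qed

lemma dsize_pos: "1 \<le> dsize x"
  by (cases x) auto

lemma dsize_dfst: "dsize (dfst x) \<le> dsize x" and dsize_dsnd: "dsize (dsnd x) \<le> dsize x"
  by (cases x; simp)+

lemma bounded_evalI: "eval P xs e v t \<Longrightarrow> t \<le> k * M \<Longrightarrow> dsize v \<le> M \<Longrightarrow> bounded_eval P M xs e v k"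
  by (auto simp: bounded_eval_def)

lemma bounded_evalE:
  assumes "bounded_eval P M xs e v k"
  obtains t where "eval P xs e v t" "t \<le> k * M" "dsize v \<le> M"
  using assms by (auto simp: bounded_eval_def)

text \<open>Beyond its subexpressions a step takes one unit or the size of its value, hence at most
  \<open>M\<close>. The bound \<open>3 \<le> M\<close> covers the truth values yielded by
  \<open>EEq\<close>.\<close>

lemma run_sound:
  shows "run P M xs e = Some (v, k) \<Longrightarrow> \<forall>x\<in>set xs. dsize x \<le> M \<Longrightarrow> 3 \<le> M \<Longrightarrow>
      bounded_eval P M xs e v k"
    and "run_list P M xs es = Some (vs, k) \<Longrightarrow> \<forall>x\<in>set xs. dsize x \<le> M \<Longrightarrow> 3 \<le> M \<Longrightarrow>
      (\<forall>x\<in>set vs. dsize x \<le> M) \<and> (\<exists>t\<le>k * M. evals P xs es vs t)"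
proof (induction P M xs e and P M xs es arbitrary: v k and vs k rule: run_run_list.induct)
  case (1 P M xs n)
  then have "n < length xs" "v = xs ! n" "k = 1"
    by (auto split: if_splits)
  then show ?case
    using 1 by (auto intro!: bounded_evalI[OF eval_Arg])
next
  case (2 P M xs)
  then show ?case
    by (auto intro: bounded_evalI[OF eval_Atom])
next
  case (3 P M xs e1 e2)
  obtain v1 k1 v2 k2 where r: "run P M xs e1 = Some (v1, k1)" "run P M xs e2 = Some (v2, k2)"
    "dsize (Dot v1 v2) \<le> M" "v = Dot v1 v2" "k = k1 + k2 + 1"
    using 3(3) by (auto split: option.splits if_splits)
  have "bounded_eval P M xs e1 v1 k1" "bounded_eval P M xs e2 v2 k2"
    using 3(1)[OF r(1)] 3(2)[OF r(1) _ r(2)] 3(4,5) by auto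
  then obtain t1 t2 where t: "t1 \<le> k1 * M" "eval P xs e1 v1 t1" "t2 \<le> k2 * M" "eval P xs e2 v2 t2"
    by (elim bounded_evalE)
  show ?case
    using r t by (auto simp: algebra_simps intro!: bounded_evalI[OF eval_Dot[OF t(2,4)]])
next
  case (4 P M xs e)
  obtain w l where r: "run P M xs e = Some (w, l)" "v = dfst w" "k = l + 1"
    using 4(2) by (auto split: option.splits)
  obtain t where t: "eval P xs e w t" "t \<le> l * M" "dsize w \<le> M"
    using 4(1)[OF r(1) 4(3,4)] by (rule bounded_evalE)
  show ?case
    using r t dsize_dfst[of w] by (auto intro!: bounded_evalI[OF eval_Fst[OF t(1)]])
next
  case (5 P M xs e)
  obtain w l where r: "run P M xs e = Some (w, l)" "v = dsnd w" "k = l + 1"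
    using 5(2) by (auto split: option.splits)
  obtain t where t: "eval P xs e w t" "t \<le> l * M" "dsize w \<le> M"
    using 5(1)[OF r(1) 5(3,4)] by (rule bounded_evalE)
  show ?case
    using r t dsize_dsnd[of w] by (auto intro!: bounded_evalI[OF eval_Snd[OF t(1)]])
next
  case (6 P M xs e1 e2)
  obtain v1 k1 v2 k2 where r: "run P M xs e1 = Some (v1, k1)" "run P M xs e2 = Some (v2, k2)"
    "v = enc_bool (v1 = v2)" "k = k1 + k2 + 1"
    using 6(3) by (auto split: option.splits)
  have size: "dsize (enc_bool (v1 = v2)) \<le> M"
    using 6(5) by (cases "v1 = v2") auto
  have "bounded_eval P M xs e1 v1 k1" "bounded_eval P M xs e2 v2 k2"
    using 6(1)[OF r(1)] 6(2)[OF r(1) _ r(2)] 6(4,5) by auto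
  then obtain t1 t2 where t: "t1 \<le> k1 * M" "eval P xs e1 v1 t1" "t2 \<le> k2 * M" "eval P xs e2 v2 t2"
    by (elim bounded_evalE)
  show ?case
    unfolding r(3) by (rule bounded_evalI[OF eval_Eq[OF t(2,4)]])
      (use r t size in \<open>simp_all add: algebra_simps\<close>)
next
  case (7 P M xs e e1 e2)
  obtain w l where w: "run P M xs e = Some (w, l)"
    using 7(4) by (auto split: option.splits)
  obtain t where t: "eval P xs e w t" "t \<le> l * M"
    using 7(1)[OF w 7(5,6)] by (rule bounded_evalE)
  show ?case
  proof (cases "w = Atom")
    case True
    then obtain l' where r: "run P M xs e2 = Some (v, l')" "k = l + l' + 1"
      using 7(4) w by (auto split: option.splits)
    obtain t' where t': "eval P xs e2 v t'" "t' \<le> l' * M" "dsize v \<le> M"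
      using 7(2)[OF w _ True r(1) 7(5,6)] by (auto elim: bounded_evalE)
    show ?thesis
      by (rule bounded_evalI[OF eval_If_False[OF t(1)[unfolded True] t'(1)]])
        (use r t t' 7(6) in \<open>simp_all add: algebra_simps\<close>)
  next
    case False
    then obtain l' where r: "run P M xs e1 = Some (v, l')" "k = l + l' + 1"
      using 7(4) w by (auto split: option.splits)
    obtain t' where t': "eval P xs e1 v t'" "t' \<le> l' * M" "dsize v \<le> M"
      using 7(3)[OF w _ False r(1) 7(5,6)] by (auto elim: bounded_evalE)
    show ?thesis
      by (rule bounded_evalI[OF eval_If_True[OF t(1) False t'(1)]])
        (use r t t' 7(6) in \<open>simp_all add: algebra_simps\<close>)
  qed
next
  case (8 P M xs f es)
  obtain ws l l' where r: "run_list P M xs es = Some (ws, l)" "call P M f ws = Some (v, l')"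
    "k = l + l' + 1"
    using 8(2) by (auto split: option.splits)
  obtain t where t: "t \<le> l * M" "evals P xs es ws t"
    using 8(1)[OF r(1) 8(3,4)] by auto
  obtain t' where t': "eval P ws (P ! f) v t'" "t' \<le> l' * M" "dsize v \<le> M"
    using call_SomeD(2)[OF r(2)] by (rule bounded_evalE)
  show ?case
    by (rule bounded_evalI[OF eval_Call[OF call_SomeD(1)[OF r(2)] t(2) t'(1)]])
      (use r t t' 8(4) in \<open>simp_all add: algebra_simps\<close>)
next
  case (9 P M xs)
  then show ?case
    by (auto intro: evals_Nil)
next
  case (10 P M xs e es)
  obtain w l ws l' where r: "run P M xs e = Some (w, l)" "run_list P M xs es = Some (ws, l')"
    "vs = w # ws" "k = l + l'"
    using 10(3) by (auto split: option.splits)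
  obtain t where t: "eval P xs e w t" "t \<le> l * M" "dsize w \<le> M"
    using 10(1)[OF r(1) 10(4,5)] by (rule bounded_evalE)
  obtain t' where t': "t' \<le> l' * M" "evals P xs es ws t'" "\<forall>x\<in>set ws. dsize x \<le> M"
    using 10(2)[OF r(1) _ r(2) 10(4,5)] by auto
  have "t + t' \<le> k * M"
    using r t t' by (simp add: algebra_simps)
  then show ?case
    using r t t' evals_Cons[OF t(1) t'(2)] by auto
qed

text \<open>The exact count in \<open>call\<close> is hidden behind an upper bound, so that the
  estimates can use round constants.\<close>

definition costs :: "program \<Rightarrow> nat \<Rightarrow> nat \<Rightarrow> data list \<Rightarrow> data \<Rightarrow> nat \<Rightarrow> bool" where
  "costs P M f vs v k \<longleftrightarrow> (\<exists>k'\<le>k. call P M f vs = Some (v, k'))"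

lemma costsI:
  assumes "run P M vs (P ! f) = Some (v, k')" "k' \<le> k"
    and "f < length P" "3 \<le> M" "\<forall>x\<in>set vs. dsize x \<le> M"
  shows "costs P M f vs v k"
  using call_SomeI[OF assms(3) run_sound(1)[OF assms(1,5,4)]] assms(2)
  by (auto simp: costs_def intro: order_trans)

lemma costsE:
  assumes "costs P M f vs v k"
  obtains k' where "call P M f vs = Some (v, k')" "k' \<le> k"
  using assms by (auto simp: costs_def)

lemma costs_mono: "costs P M f vs v k \<Longrightarrow> k \<le> k' \<Longrightarrow> costs P M f vs v k'"
  by (auto simp: costs_def intro: order_trans)

lemma costs_runs:
  assumes "costs P M 0 [x] y k"
  shows "\<exists>t\<le>k * M. runs P x y t"
proof -
  obtain k' where "call P M 0 [x] = Some (y, k')" "k' \<le> k"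
    using assms by (rule costsE)
  then show ?thesis
    using call_SomeD[of P M 0 "[x]" y k']
    by (auto simp: bounded_eval_def runs_def intro: order_trans mult_le_mono1)
qed

section \<open>The program\<close>

abbreviation (input) "f_translate \<equiv> 1 :: nat"
abbreviation (input) "f_append \<equiv> 2 :: nat"
abbreviation (input) "f_loc \<equiv> 3 :: nat"
abbreviation (input) "f_body_loc \<equiv> 4 :: nat"
abbreviation (input) "f_clause \<equiv> 5 :: nat"
abbreviation (input) "f_drop \<equiv> 6 :: nat"
abbreviation (input) "f_longer \<equiv> 7 :: nat"
abbreviation (input) "f_subf \<equiv> 8 :: nat"
abbreviation (input) "f_member \<equiv> 9 :: nat"
abbreviation (input) "f_cons_option \<equiv> 10 :: nat"
abbreviation (input) "f_or \<equiv> 11 :: nat"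
abbreviation (input) "f_find \<equiv> 12 :: nat"
abbreviation (input) "f_up \<equiv> 13 :: nat"
abbreviation (input) "f_down \<equiv> 14 :: nat"
abbreviation (input) "f_leaf \<equiv> 15 :: nat"
abbreviation (input) "f_leaf_tree \<equiv> 16 :: nat"
abbreviation (input) "f_removal_tree \<equiv> 17 :: nat"
abbreviation (input) "f_lower \<equiv> 18 :: nat"
abbreviation (input) "f_resolution_tree \<equiv> 19 :: nat"
abbreviation (input) "f_branch \<equiv> 20 :: nat"

abbreviation (input) "e_true \<equiv> EDot EAtom EAtom"
abbreviation (input) "e_list1 x \<equiv> EDot x EAtom"
abbreviation (input) "e_1 \<equiv> EDot e_true EAtom"
abbreviation (input) "e_2 \<equiv> EDot EAtom (EDot e_true EAtom)"
abbreviation (input) "e_3 \<equiv> EDot e_true (EDot e_true EAtom)"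
abbreviation (input) "e_4 \<equiv> EDot EAtom (EDot EAtom (EDot e_true EAtom))"

definition main_body :: expr where
  "main_body = ECall f_translate [EFst (EArg 0), ESnd (EArg 0)]"

text \<open>The \<open>let\<close> belongs to HOL and only abbreviates program text: an expression
  named once and used twice is evaluated twice. Only projections are repeated here; each recursive
  call occurs once per child.\<close>

definition translate_body :: expr where
  "translate_body =
     (let S = EFst (EArg 1); a = EFst (ESnd (EArg 1)); ts = ESnd (ESnd (EArg 1));
        t = EFst ts; u = EFst (ESnd ts) in
      EIf ts
       (EIf (ESnd ts)
         (ECall f_branch
           [ECall f_body_loc [S], ECall f_body_loc [EFst t], ECall f_body_loc [EFst u],
            ECall f_clause [a], ECall f_clause [EFst (ESnd t)], ECall f_clause [EFst (ESnd u)],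
            ECall f_translate [EArg 0, t], ECall f_translate [EArg 0, u]])
         (ECall f_removal_tree
           [ECall f_body_loc [S], ECall f_loc [EFst t], ECall f_clause [a],
            ECall f_translate [EArg 0, t]]))
       (ECall f_leaf_tree [EArg 0, ECall f_body_loc [S], ECall f_clause [a]]))"

definition append_body :: expr where
  "append_body =
     EIf (EArg 0) (EDot (EFst (EArg 0)) (ECall f_append [ESnd (EArg 0), EArg 1])) (EArg 1)"

definition loc_body :: expr where
  "loc_body =
     EIf (EArg 0)
       (EIf (ESnd (EArg 0)) (ECall f_loc [ESnd (EArg 0)]) (EFst (EFst (EArg 0))))
       EAtom"

definition body_loc_body :: expr where
  "body_loc_body =
     EIf (EArg 0) (ECall f_append [ECall f_loc [EArg 0], e_list1 EAtom]) EAtom"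

text \<open>Comparison with \<open>EAtom\<close>, the encoding of \<open>False\<close>, negates the
  truth value.\<close>

definition clause_body :: expr where
  "clause_body =
     EIf (EArg 0)
       (EDot (EDot (EFst (EFst (EArg 0))) (EEq (ESnd (EFst (EArg 0))) EAtom))
         (ECall f_clause [ESnd (EArg 0)]))
       EAtom"

definition drop_body :: expr where
  "drop_body = EIf (EArg 0) (ECall f_drop [ESnd (EArg 0), ESnd (EArg 1)]) (EArg 1)"

definition longer_body :: expr where
  "longer_body = EIf (ECall f_drop [EArg 0, EArg 1]) (EArg 1) (EArg 0)"

text \<open>The direction is consulted only under tag 1, a conjunction. The body of a quantification
  is stored to the right of its variable, in the place of a second conjunct.\<close>

definition subf_body :: expr where
  "subf_body =
     (let parts = ESnd (EArg 0) in
      EIf (EArg 1)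
       (ECall f_subf
         [EIf (EEq (EFst (EArg 0)) e_1)
            (EIf (EFst (EArg 1)) (ESnd parts) (EFst parts))
            (ESnd parts),
          ESnd (EArg 1)])
       (EArg 0))"

definition member_body :: expr where
  "member_body =
     EIf (EArg 1)
       (EIf (EEq (EArg 0) (EFst (EFst (EArg 1)))) e_true (ECall f_member [EArg 0, ESnd (EArg 1)]))
       EAtom"

text \<open>An optional index is encoded by \<^const>\<open>Atom\<close> or by a \<^const>\<open>Dot\<close> with the index on its right.\<close>

definition cons_option_body :: expr where
  "cons_option_body =
     EIf (EArg 1) (EDot EAtom (EDot (EArg 0) (ESnd (EArg 1)))) EAtom"

text \<open>As a function, and not as a conditional in \<open>find_body\<close>, the disjunction evaluates each of its
  arguments once. Evaluating one of them twice would take time exponential in the depth.\<close>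

definition or_body :: expr where
  "or_body = EIf (EArg 0) (EArg 0) (EArg 1)"

definition find_body :: expr where
  "find_body =
     (let tag = EFst (EArg 0); parts = ESnd (EArg 0) in
      EIf tag
       (EIf (EEq tag e_1)
         (ECall f_or
           [ECall f_cons_option [EAtom, ECall f_find [EFst parts, EArg 1]],
            ECall f_cons_option [e_true, ECall f_find [ESnd parts, EArg 1]]])
         (EIf (ECall f_member [EFst parts, EArg 1])
           EAtom
           (ECall f_cons_option [EAtom, ECall f_find [ESnd parts, EArg 1]])))
       (EIf (EEq parts (EArg 1)) (EDot EAtom EAtom) EAtom))"

definition up_body :: expr where
  "up_body =
     EIf (EArg 1)
       (EDot (EDot (EArg 0) (EArg 2)) (EDot e_2 (e_list1
         (ECall f_up
           [ECall f_append [EArg 0, e_list1 (EFst (EArg 1))], ESnd (EArg 1), EArg 2, EArg 3]))))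
       (EArg 3)"

definition down_body :: expr where
  "down_body =
     (let j = ECall f_append [EArg 0, e_list1 (EFst (EArg 1))] in
      EIf (EArg 1)
       (ECall f_down
         [j, ESnd (EArg 1), EArg 2, EDot (EDot j (EArg 2)) (EDot e_4 (e_list1 (EArg 3)))])
       (EArg 3))"

definition leaf_body :: expr where
  "leaf_body =
     ECall f_up [EArg 0, EArg 2, EArg 1,
       EDot (EDot (ECall f_append [EArg 0, EArg 2]) (EArg 1)) (EDot EAtom EAtom)]"

definition leaf_tree_body :: expr where
  "leaf_tree_body =
     ECall f_leaf [EArg 1, EArg 2,
       ESnd (ECall f_find [ECall f_subf [EArg 0, EArg 1], EArg 2])]"

definition removal_tree_body :: expr where
  "removal_tree_body =
     ECall f_up [EArg 0, ECall f_drop [EArg 0, EArg 1], EArg 2,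
       EDot (EDot (EArg 1) (EArg 2)) (EDot e_3 (e_list1 (EArg 3)))]"

definition lower_body :: expr where
  "lower_body = ECall f_down [EArg 0, ECall f_drop [EArg 0, EArg 1], EArg 2, EArg 3]"

definition resolution_tree_body :: expr where
  "resolution_tree_body =
     ECall f_up [EArg 0, ECall f_drop [EArg 0, EArg 1], EArg 2,
       EDot (EDot (EArg 1) (EArg 2)) (EDot e_1 (EDot (EArg 3) (e_list1 (EArg 4))))]"

text \<open>A function of its own, so that locations and clauses of the children arrive as values
  that can be used repeatedly. Only \<open>i\<close> is recomputed, three times in all.\<close>

definition branch_body :: expr where
  "branch_body =
     (let i = ECall f_longer [EArg 1, EArg 2] in
      ECall f_resolution_tree
       [EArg 0, i, EArg 3,
        ECall f_lower [EArg 1, i, EArg 4, EArg 6], ECall f_lower [EArg 2, i, EArg 5, EArg 7]])"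

definition prog :: program where
  "prog =
     [main_body, translate_body, append_body, loc_body, body_loc_body, clause_body, drop_body,
      longer_body, subf_body, member_body, cons_option_body, or_body, find_body, up_body,
      down_body, leaf_body, leaf_tree_body, removal_tree_body, lower_body, resolution_tree_body,
      branch_body]"

section \<open>Running time\<close>

lemma length_prog: "length prog = 21"
  by (simp add: prog_def)

lemma prog_nth:
  "prog ! 0 = main_body" "prog ! Suc 0 = translate_body" "prog ! f_append = append_body"
  "prog ! f_loc = loc_body" "prog ! f_body_loc = body_loc_body" "prog ! f_clause = clause_body"
  "prog ! f_drop = drop_body" "prog ! f_longer = longer_body" "prog ! f_subf = subf_body"
  "prog ! f_member = member_body" "prog ! f_cons_option = cons_option_body"
  "prog ! f_or = or_body" "prog ! f_find = find_body" "prog ! f_up = up_body"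
  "prog ! f_down = down_body" "prog ! f_leaf = leaf_body" "prog ! f_leaf_tree = leaf_tree_body"
  "prog ! f_removal_tree = removal_tree_body" "prog ! f_lower = lower_body"
  "prog ! f_resolution_tree = resolution_tree_body" "prog ! f_branch = branch_body"
  by (simp_all add: prog_def)

text \<open>The rule behind the cost lemmas for the program functions: its first premise is
  discharged by unfolding one body and rewriting with \<open>call\<close> facts for the functions
  used there. The bound 20 leaves room for all constants in the program; the largest tags have size
  9.\<close>

lemma costs_progI:
  assumes "\<exists>k'\<le>k. run prog M vs (prog ! f) = Some (v, k')"
    and "f < 21" "20 \<le> M" "\<forall>x\<in>set vs. dsize x \<le> M"
  shows "costs prog M f vs v k"
  using assms costsI[of prog M vs f v _ k] by (auto simp: length_prog)

section \<open>Cost of operations on lists and labels\<close>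

lemma dsize_enc_list_append: "dsize (enc_list (xs @ ys)) + 1 = dsize (enc_list xs) + dsize (enc_list ys)"
  by (induction xs) auto

lemma length_le_dsize_enc_list: "length xs < dsize (enc_list xs)"
  by (induction xs) auto

lemma enc_list_eq_Atom [simp]: "enc_list xs = Atom \<longleftrightarrow> xs = []"
  by (cases xs) auto

lemma enc_bool_eq_Atom [simp]: "enc_bool b = Atom \<longleftrightarrow> \<not> b"
  by (cases b) auto

lemma costs_append:
  assumes "20 \<le> M"
  shows "dsize (enc_list (xs @ ys)) \<le> M \<Longrightarrow>
    costs prog M f_append [enc_list xs, enc_list ys] (enc_list (xs @ ys)) (10 * length xs + 10)"
proof (induction xs)
  case Nil
  then show ?case
    using assms by (intro costs_progI) (simp_all add: prog_nth append_body_def)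
next
  case (Cons x xs)
  then obtain k where "call prog M f_append [enc_list xs, enc_list ys] = Some (enc_list (xs @ ys), k)"
    "k \<le> 10 * length xs + 10"
    by (auto elim: costsE)
  then show ?case
    using assms Cons.prems dsize_enc_list_append[of xs ys] dsize_pos[of "enc_list xs"]
      dsize_pos[of "enc_list ys"]
    by (intro costs_progI) (simp_all add: prog_nth append_body_def)
qed

lemma costs_drop:
  assumes "20 \<le> M"
  shows "dsize (enc_list xs) \<le> M \<Longrightarrow> dsize (enc_list ys) \<le> M \<Longrightarrow>
    costs prog M f_drop [enc_list xs, enc_list ys] (enc_list (drop (length xs) ys))
      (10 * length xs + 10)"
proof (induction xs arbitrary: ys)
  case Nil
  then show ?case
    using assms by (intro costs_progI) (simp_all add: prog_nth drop_body_def)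
next
  case (Cons x xs)
  have tl: "dsnd (enc_list ys) = enc_list (tl ys)" "dsize (enc_list (tl ys)) \<le> M"
    using Cons.prems by (cases ys; simp)+
  then obtain k where
    "call prog M f_drop [enc_list xs, enc_list (tl ys)] = Some (enc_list (drop (length xs) (tl ys)), k)"
    "k \<le> 10 * length xs + 10"
    using Cons by (auto elim: costsE)
  then show ?case
    using assms Cons.prems tl
    by (intro costs_progI) (simp_all add: prog_nth drop_body_def drop_Suc)
qed

lemma costs_longer:
  assumes "20 \<le> M" "dsize (enc_list xs) \<le> M" "dsize (enc_list ys) \<le> M"
  shows "costs prog M f_longer [enc_list xs, enc_list ys] (enc_list (longer xs ys))
    (10 * length xs + 20)"
proof -
  obtain k where
    "call prog M f_drop [enc_list xs, enc_list ys] = Some (enc_list (drop (length xs) ys), k)"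
    "k \<le> 10 * length xs + 10"
    using costs_drop[OF assms] by (auto elim: costsE)
  then show ?thesis
    using assms by (intro costs_progI) (simp_all add: prog_nth longer_body_def longer_def)
qed

text \<open>\<open>f_loc\<close> makes no comparisons: a set is encoded as an increasing list, so
  its maximum is the last entry.\<close>

lemma costs_last:
  assumes "20 \<le> M"
  shows "dsize (enc_list (map enc_locvar ps)) \<le> M \<Longrightarrow>
    costs prog M f_loc [enc_list (map enc_locvar ps)]
      (enc_index (if ps = [] then [] else fst (last ps))) (20 * length ps + 20)"
proof (induction ps)
  case Nil
  then show ?case
    using assms by (intro costs_progI) (simp_all add: prog_nth loc_body_def enc_index_def)
next
  case (Cons p ps)
  show ?case
  proof (cases "ps = []")
    case True
    then show ?thesis
      using assms Cons.prems
      by (intro costs_progI) (simp_all add: prog_nth loc_body_def enc_locvar_def)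
  next
    case False
    then obtain k where
      "call prog M f_loc [enc_list (map enc_locvar ps)] = Some (enc_index (fst (last ps)), k)"
      "k \<le> 20 * length ps + 20"
      using Cons by (auto elim: costsE)
    then show ?thesis
      using assms Cons.prems False
      by (intro costs_progI) (simp_all add: prog_nth loc_body_def)
  qed
qed

lemma last_sorted_list_of_set:
  fixes A :: "'a::linorder set"
  assumes "finite A" "A \<noteq> {}"
  shows "last (sorted_list_of_set A) = Max A"
proof -
  obtain ys z where ys: "sorted_list_of_set A = ys @ [z]"
    using assms by (metis rev_exhaust sorted_list_of_set_eq_Nil_iff)
  have "sorted (ys @ [z])" "set (ys @ [z]) = A"
    using assms(1) by (simp_all flip: ys)
  then have "Max A = z"
    using assms(1) by (intro Max_eqI) (auto simp: sorted_append)
  then show ?thesis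
    by (simp add: ys)
qed

lemma costs_loc:
  assumes "20 \<le> M" "finite S" "dsize (enc_set enc_locvar S) \<le> M"
  shows "costs prog M f_loc [enc_set enc_locvar S] (enc_index (loc S))
    (20 * dsize (enc_set enc_locvar S) + 20)"
proof (rule costs_mono)
  show "costs prog M f_loc [enc_set enc_locvar S] (enc_index (loc S))
      (20 * length (sorted_list_of_set S) + 20)"
    using costs_last[of M "sorted_list_of_set S"] assms last_sorted_list_of_set[of S]
    by (cases "S = {}") (simp_all add: enc_set_def loc_def)
  show "20 * length (sorted_list_of_set S) + 20 \<le> 20 * dsize (enc_set enc_locvar S) + 20"
    using length_le_dsize_enc_list[of "map enc_locvar (sorted_list_of_set S)"]
    by (simp add: enc_set_def)
qed

lemma costs_body_loc:
  assumes "20 \<le> M" "finite S" "dsize (enc_set enc_locvar S) \<le> M"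
    and "dsize (enc_index (body_loc S)) \<le> M"
  shows "costs prog M f_body_loc [enc_set enc_locvar S] (enc_index (body_loc S))
    (20 * dsize (enc_set enc_locvar S) + 10 * length (body_loc S) + 50)"
proof (cases "S = {}")
  case True
  then show ?thesis
    using assms
    by (intro costs_progI) (simp_all add: prog_nth body_loc_body_def enc_set_def body_loc_def enc_index_def)
next
  case False
  have "enc_set enc_locvar S \<noteq> Atom"
    using False assms(2) by (simp add: enc_set_def)
  moreover obtain k where
    "call prog M f_loc [enc_set enc_locvar S] = Some (enc_index (loc S), k)"
    "k \<le> 20 * dsize (enc_set enc_locvar S) + 20"
    using costs_loc[OF assms(1-3)] by (rule costsE)
  moreover have "body_loc S = loc S @ [False]"
    using False by (simp add: body_loc_def)
  moreover from this obtain l where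
    "call prog M f_append [enc_index (loc S), Dot Atom Atom] = Some (enc_index (body_loc S), l)"
    "l \<le> 10 * length (loc S) + 10"
    using costs_append[OF assms(1), of "map enc_bool (loc S)" "[Atom]"] assms(4)
    by (auto simp: enc_index_def elim: costsE)
  ultimately show ?thesis
    using assms
    by (intro costs_progI) (simp_all add: prog_nth body_loc_body_def)
qed

text \<open>Distinct pairs of an assignment have distinct variables, so negating the truth values does not
  change the order and the program need not sort.\<close>

lemma sorted_list_of_falsified_clause:
  assumes "finite (dom a)"
  shows "sorted_list_of_set (falsified_clause a) =
    map (\<lambda>(v, b). (v, \<not> b)) (sorted_list_of_set (Map.graph a))"
proof -
  let ?xs = "sorted_list_of_set (Map.graph a)"
  let ?neg = "\<lambda>(v, b). (v, \<not> b)"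
  have fin: "finite (Map.graph a)"
    using assms by (simp add: finite_graph_iff_finite_dom)
  have "sorted_wrt (<) ?xs"
    by simp
  then have "sorted_wrt (\<lambda>x y. ?neg x < ?neg y) ?xs"
  proof (rule sorted_wrt_mono_rel[rotated])
    fix x y
    assume "x \<in> set ?xs" "y \<in> set ?xs" "x < y"
    moreover from this have "fst x \<noteq> fst y"
      using fin by (auto simp: Map.graph_def)
    ultimately show "?neg x < ?neg y"
      by (auto simp: less_prod_def split: prod.splits)
  qed
  then have "sorted_wrt (<) (map ?neg ?xs)"
    by (simp add: sorted_wrt_map)
  moreover have "set (map ?neg ?xs) = falsified_clause a"
    using fin by (simp add: falsified_clause_def)
  ultimately show ?thesis
    by (metis sorted_list_of_set.idem_if_sorted_distinct strict_sorted_iff)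
qed

text \<open>Negating may turn a truth value of size 1 into one of size 3. The list cell and the pair
  around it are large enough for a factor of 2 to absorb this.\<close>

lemma costs_neg:
  assumes "20 \<le> M"
  shows "2 * dsize (enc_list (map (\<lambda>(v, b). Dot (enc_nat v) (enc_bool b)) ps)) \<le> M \<Longrightarrow>
    dsize (enc_list (map enc_literal (map (\<lambda>(v, b). (v, \<not> b)) ps))) \<le>
      2 * dsize (enc_list (map (\<lambda>(v, b). Dot (enc_nat v) (enc_bool b)) ps)) \<and>
    costs prog M f_clause [enc_list (map (\<lambda>(v, b). Dot (enc_nat v) (enc_bool b)) ps)]
      (enc_list (map enc_literal (map (\<lambda>(v, b). (v, \<not> b)) ps))) (20 * length ps + 20)"
proof (induction ps)
  case Nil
  then show ?case
    using assms by (auto intro!: costs_progI simp: prog_nth clause_body_def)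
next
  case (Cons p ps)
  obtain v b where p: "p = (v, b)" by fastforce
  let ?x = "enc_list (map (\<lambda>(v, b). Dot (enc_nat v) (enc_bool b)) ps)"
  let ?y = "enc_list (map enc_literal (map (\<lambda>(v, b). (v, \<not> b)) ps))"
  have IH: "dsize ?y \<le> 2 * dsize ?x" "costs prog M f_clause [?x] ?y (20 * length ps + 20)"
    using Cons by auto
  obtain k where k: "call prog M f_clause [?x] = Some (?y, k)" "k \<le> 20 * length ps + 20"
    using IH(2) by (rule costsE)
  have size: "dsize (enc_list (map enc_literal (map (\<lambda>(v, b). (v, \<not> b)) (p # ps)))) \<le>
      2 * dsize (enc_list (map (\<lambda>(v, b). Dot (enc_nat v) (enc_bool b)) (p # ps)))"
    using IH(1) p by (cases b) (simp_all add: enc_literal_def)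
  moreover have "costs prog M f_clause [enc_list (map (\<lambda>(v, b). Dot (enc_nat v) (enc_bool b)) (p # ps))]
      (enc_list (map enc_literal (map (\<lambda>(v, b). (v, \<not> b)) (p # ps)))) (20 * length (p # ps) + 20)"
    using assms Cons.prems k size p
    by (intro costs_progI) (simp_all add: prog_nth clause_body_def enc_literal_def)
  ultimately show ?case ..
qed

lemma costs_clause:
  assumes "20 \<le> M" "finite (dom a)" "2 * dsize (enc_assignment a) \<le> M"
  shows "dsize (enc_clause (falsified_clause a)) \<le> 2 * dsize (enc_assignment a)"
    and "costs prog M f_clause [enc_assignment a] (enc_clause (falsified_clause a))
      (20 * dsize (enc_assignment a) + 20)"
proof -
  let ?ps = "sorted_list_of_set (Map.graph a)"
  have "length ?ps \<le> dsize (enc_assignment a)"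
    using length_le_dsize_enc_list[of "map (\<lambda>(v, b). Dot (enc_nat v) (enc_bool b)) ?ps"]
    by (simp add: enc_assignment_def enc_set_def)
  then show "dsize (enc_clause (falsified_clause a)) \<le> 2 * dsize (enc_assignment a)"
    and "costs prog M f_clause [enc_assignment a] (enc_clause (falsified_clause a))
      (20 * dsize (enc_assignment a) + 20)"
    using costs_neg[OF assms(1), of ?ps] sorted_list_of_falsified_clause[OF assms(2)] assms(3)
    by (auto simp: enc_assignment_def enc_clause_def enc_set_def intro: costs_mono)
qed

section \<open>Injectivity of the encodings\<close>

lemma bits_0: "bits 0 = []"
  by (simp add: bits.simps[of 0])

lemma bits_nonzero: "n \<noteq> 0 \<Longrightarrow> bits n = odd n # bits (n div 2)"
  by (simp add: bits.simps[of n])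

lemma inj_bits: "bits m = bits n \<Longrightarrow> m = n"
proof (induction m arbitrary: n rule: less_induct)
  case (less m)
  show ?case
  proof (cases "m = 0 \<or> n = 0")
    case True
    then show ?thesis
      using less.prems bits_0 bits_nonzero by (metis list.distinct(1))
  next
    case False
    then have "odd m # bits (m div 2) = odd n # bits (n div 2)"
      using less.prems bits_nonzero by metis
    then have "odd m = odd n" "m div 2 = n div 2"
      using False less.IH[of "m div 2" "n div 2"] by auto
    then show ?thesis
      by presburger
  qed
qed

lemma inj_enc_bool: "inj enc_bool"
proof (rule injI)
  show "b = c" if "enc_bool b = enc_bool c" for b c
    using that by (cases b; cases c) auto
qed

lemma inj_enc_list: "enc_list xs = enc_list ys \<Longrightarrow> xs = ys"
proof (induction xs arbitrary: ys)
  case (Cons x xs)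
  then show ?case by (cases ys) auto
next
  case Nil
  then show ?case by (cases ys) auto
qed

lemma enc_nat_inject [simp]: "enc_nat m = enc_nat n \<longleftrightarrow> m = n"
  by (auto simp: enc_nat_def dest!: inj_enc_list inj_bits dest: map_injective[OF _ inj_enc_bool])

lemma inj_enc_literal: "inj enc_literal"
  by (rule injI) (auto simp: enc_literal_def prod_eq_iff dest: injD[OF inj_enc_bool])

text \<open>The search compares clauses through \<open>EEq\<close>, that is, by their encodings.
  Finiteness matters, as an infinite set has the same encoding as the empty one.\<close>

lemma enc_clause_inject:
  assumes "finite \<alpha>" "finite \<beta>"
  shows "enc_clause \<alpha> = enc_clause \<beta> \<longleftrightarrow> \<alpha> = \<beta>"
proof
  assume "enc_clause \<alpha> = enc_clause \<beta>"
  then have "sorted_list_of_set \<alpha> = sorted_list_of_set \<beta>"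
    by (auto simp: enc_clause_def enc_set_def
        dest!: inj_enc_list dest: map_injective[OF _ inj_enc_literal])
  then show "\<alpha> = \<beta>"
    using assms sorted_list_of_set_inject by blast
qed simp

lemma enc_nat_simps:
  "enc_nat 0 = Atom"
  "enc_nat (Suc 0) = Dot (Dot Atom Atom) Atom"
  "enc_nat 2 = Dot Atom (Dot (Dot Atom Atom) Atom)"
  "enc_nat 3 = Dot (Dot Atom Atom) (Dot (Dot Atom Atom) Atom)"
  "enc_nat 4 = Dot Atom (Dot Atom (Dot (Dot Atom Atom) Atom))"
  by (simp_all add: enc_nat_def bits_0 bits_nonzero)

lemma enc_index_simps:
  "enc_index [] = Atom" "enc_index (d # i) = Dot (enc_bool d) (enc_index i)"
  by (simp_all add: enc_index_def)

lemma enc_index_eq_Atom [simp]: "enc_index i = Atom \<longleftrightarrow> i = []"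
  by (simp add: enc_index_def)

section \<open>Cost of walking and searching in a formula\<close>

lemma costs_subf:
  assumes "20 \<le> M"
  shows "subf \<psi> j = Some \<phi> \<Longrightarrow> dsize (enc_qform \<psi>) \<le> M \<Longrightarrow> dsize (enc_index j) \<le> M \<Longrightarrow>
    costs prog M f_subf [enc_qform \<psi>, enc_index j] (enc_qform \<phi>) (50 * length j + 10)"
proof (induction j arbitrary: \<psi>)
  case Nil
  then show ?case
    using assms by (intro costs_progI) (simp_all add: prog_nth subf_body_def Let_def enc_index_simps)
next
  case (Cons d j)
  have j: "dsize (enc_index j) \<le> M"
    using Cons.prems by (simp add: enc_index_simps)
  show ?case
  proof (cases \<psi>)
    case (Clause \<alpha>)
    then show ?thesis
      using Cons.prems by simp
  next
    case (And \<psi>1 \<psi>2)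
    obtain k where "call prog M f_subf [enc_qform (if d then \<psi>2 else \<psi>1), enc_index j] =
        Some (enc_qform \<phi>, k)" "k \<le> 50 * length j + 10"
      using Cons.IH[of "if d then \<psi>2 else \<psi>1"] Cons.prems And j
      by (auto elim: costsE split: if_splits)
    then show ?thesis
      using assms Cons.prems And
      by (intro costs_progI; cases d)
        (simp_all add: prog_nth subf_body_def Let_def enc_index_simps enc_nat_simps)
  next
    case (Forall v \<psi>')
    then have d: "\<not> d" "subf \<psi>' j = Some \<phi>"
      using Cons.prems(1) by (simp_all add: subf_Forall_Cons split: if_splits)
    then obtain k where "call prog M f_subf [enc_qform \<psi>', enc_index j] =
        Some (enc_qform \<phi>, k)" "k \<le> 50 * length j + 10"
      using Cons.IH[of \<psi>'] Cons.prems Forall j by (auto elim: costsE)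
    then show ?thesis
      using assms Cons.prems Forall d
      by (intro costs_progI) (simp_all add: prog_nth subf_body_def Let_def enc_index_simps enc_nat_simps)
  next
    case (Exists v \<psi>')
    then have d: "\<not> d" "subf \<psi>' j = Some \<phi>"
      using Cons.prems(1) by (simp_all add: subf_Exists_Cons split: if_splits)
    then obtain k where "call prog M f_subf [enc_qform \<psi>', enc_index j] =
        Some (enc_qform \<phi>, k)" "k \<le> 50 * length j + 10"
      using Cons.IH[of \<psi>'] Cons.prems Exists j by (auto elim: costsE)
    then show ?thesis
      using assms Cons.prems Exists d
      by (intro costs_progI) (simp_all add: prog_nth subf_body_def Let_def enc_index_simps enc_nat_simps)
  qed
qed

lemma dfst_enc_literal: "dfst (enc_literal L) = enc_nat (fst L)"
  by (simp add: enc_literal_def)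

lemma costs_member_list:
  assumes "20 \<le> M" "dsize (enc_nat v) \<le> M"
  shows "dsize (enc_list (map enc_literal Ls)) \<le> M \<Longrightarrow>
    costs prog M f_member [enc_nat v, enc_list (map enc_literal Ls)] (enc_bool (v \<in> fst ` set Ls))
      (20 * length Ls + 20)"
proof (induction Ls)
  case Nil
  then show ?case
    using assms by (intro costs_progI) (simp_all add: prog_nth member_body_def)
next
  case (Cons L Ls)
  then obtain k where "call prog M f_member [enc_nat v, enc_list (map enc_literal Ls)] =
      Some (enc_bool (v \<in> fst ` set Ls), k)" "k \<le> 20 * length Ls + 20"
    by (auto elim: costsE)
  then show ?case
    using assms Cons.prems
    by (intro costs_progI; cases "v = fst L") (simp_all add: prog_nth member_body_def dfst_enc_literal)
qed

lemma costs_member: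
  assumes "20 \<le> M" "dsize (enc_nat v) \<le> M" "finite C" "dsize (enc_clause C) \<le> M"
  shows "costs prog M f_member [enc_nat v, enc_clause C] (enc_bool (v \<in> vars C))
    (20 * dsize (enc_clause C) + 20)"
proof (rule costs_mono)
  show "costs prog M f_member [enc_nat v, enc_clause C] (enc_bool (v \<in> vars C))
      (20 * length (sorted_list_of_set C) + 20)"
    using costs_member_list[OF assms(1,2), of "sorted_list_of_set C"] assms(3,4)
    by (simp add: enc_clause_def enc_set_def vars_def)
  show "20 * length (sorted_list_of_set C) + 20 \<le> 20 * dsize (enc_clause C) + 20"
    using length_le_dsize_enc_list[of "map enc_literal (sorted_list_of_set C)"]
    by (simp add: enc_clause_def enc_set_def)
qed

fun enc_index_option :: "index option \<Rightarrow> data" where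
  "enc_index_option None = Atom"
| "enc_index_option (Some i) = Dot Atom (enc_index i)"

lemma costs_cons_option:
  assumes "20 \<le> M" "dsize (enc_index_option x) \<le> M"
    "dsize (enc_index_option (map_option (Cons d) x)) \<le> M"
  shows "costs prog M f_cons_option [enc_bool d, enc_index_option x]
    (enc_index_option (map_option (Cons d) x)) 20"
proof -
  have "dsize (enc_bool d) \<le> M"
    using assms(1) by (cases d) auto
  then show ?thesis
    using assms
    by (intro costs_progI; cases x) (simp_all add: prog_nth cons_option_body_def enc_index_simps)
qed

lemma costs_or:
  assumes "20 \<le> M" "dsize x \<le> M" "dsize y \<le> M"
  shows "costs prog M f_or [x, y] (if x = Atom then y else x) 10"
  using assms by (intro costs_progI) (simp_all add: prog_nth or_body_def)

lemma length_index_less: "subf \<psi> i \<noteq> None \<Longrightarrow> length i < dsize (enc_qform \<psi>)"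
proof (induction \<psi> i rule: subf.induct)
  case (1 \<phi>)
  then show ?case using dsize_pos[of "enc_qform \<phi>"] by simp
next
  case (2 \<phi> \<chi> d i)
  then show ?case by (cases d) auto
qed auto

lemma dsize_enc_bool: "dsize (enc_bool b) \<le> 3"
  by (cases b) auto

lemma dsize_enc_index: "dsize (enc_index i) \<le> 4 * length i + 1"
proof (induction i)
  case (Cons d i)
  then show ?case by (cases d) (simp_all add: enc_index_simps)
qed (simp add: enc_index_simps)

text \<open>A path found is an index of \<open>\<phi>\<close>, hence shorter than the size of its
  encoding, and each of its bits takes at most four units.\<close>

lemma dsize_enc_index_option_find:
  "dsize (enc_index_option (find_clause C \<phi>)) \<le> 4 * dsize (enc_qform \<phi>)"
proof (cases "find_clause C \<phi>")
  case None
  then show ?thesis using dsize_pos[of "enc_qform \<phi>"] by simp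
next
  case (Some r)
  then have "length r < dsize (enc_qform \<phi>)"
    using find_clause_sound[OF Some] by (intro length_index_less) auto
  then show ?thesis
    using Some dsize_enc_index[of r] by simp
qed

text \<open>Each node of the syntax tree is charged at most one membership test, linear in the
  clause, and a constant. Both conjuncts are always searched, because arguments are evaluated before
  \<open>f_or\<close> chooses.\<close>

lemma costs_find:
  assumes M: "20 \<le> M" and C: "finite C" "dsize (enc_clause C) \<le> M"
  shows "clauses_ok \<phi> \<Longrightarrow> 4 * dsize (enc_qform \<phi>) \<le> M \<Longrightarrow>
    costs prog M f_find [enc_qform \<phi>, enc_clause C] (enc_index_option (find_clause C \<phi>))
      (dsize (enc_qform \<phi>) * (20 * dsize (enc_clause C) + 200))"
proof (induction \<phi>)
  case (Clause \<alpha>)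
  then have eq: "enc_clause \<alpha> = enc_clause C \<longleftrightarrow> \<alpha> = C"
    using C by (intro enc_clause_inject) (auto simp: is_clause_def)
  show ?case
    using M C Clause
    by (intro costs_progI; cases "\<alpha> = C")
      (simp_all add: prog_nth find_body_def Let_def enc_nat_simps enc_index_simps eq)
next
  case (And \<phi> \<chi>)
  define K where "K = 20 * dsize (enc_clause C) + 200"
  have size: "4 * dsize (enc_qform \<phi>) + 4 * dsize (enc_qform \<chi>) + 10 \<le> M"
    using And.prems by (simp add: enc_nat_simps)
  obtain k where k: "call prog M f_find [enc_qform \<phi>, enc_clause C] =
      Some (enc_index_option (find_clause C \<phi>), k)" "k \<le> dsize (enc_qform \<phi>) * K"
    using And by (auto simp: K_def elim: costsE)
  obtain l where l: "call prog M f_find [enc_qform \<chi>, enc_clause C] =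
      Some (enc_index_option (find_clause C \<chi>), l)" "l \<le> dsize (enc_qform \<chi>) * K"
    using And by (auto simp: K_def elim: costsE)
  let ?x = "enc_index_option (map_option (Cons False) (find_clause C \<phi>))"
  let ?y = "enc_index_option (map_option (Cons True) (find_clause C \<chi>))"
  have sizes: "dsize ?x \<le> M" "dsize ?y \<le> M"
      "dsize (enc_index_option (find_clause C \<phi>)) \<le> M" "dsize (enc_index_option (find_clause C \<chi>)) \<le> M"
    using dsize_enc_index_option_find[of C \<phi>] dsize_enc_index_option_find[of C \<chi>] size
    by (cases "find_clause C \<phi>"; cases "find_clause C \<chi>"; simp add: enc_index_simps)+
  obtain k' where k': "call prog M f_cons_option [Atom, enc_index_option (find_clause C \<phi>)] =
      Some (?x, k')" "k' \<le> 20"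
    using costs_cons_option[OF M sizes(3), of False] sizes by (auto elim: costsE)
  obtain l' where l': "call prog M f_cons_option [Dot Atom Atom, enc_index_option (find_clause C \<chi>)] =
      Some (?y, l')" "l' \<le> 20"
    using costs_cons_option[OF M sizes(4), of True] sizes by (auto elim: costsE)
  obtain m where m: "call prog M f_or [?x, ?y] =
      Some (enc_index_option (find_clause C (And \<phi> \<chi>)), m)" "m \<le> 10"
    using costs_or[OF M sizes(1,2)]
    by (cases "find_clause C \<phi>") (auto elim: costsE)
  have "dsize (enc_qform (And \<phi> \<chi>)) * K \<ge> dsize (enc_qform \<phi>) * K + dsize (enc_qform \<chi>) * K + K"
    by (simp add: algebra_simps)
  moreover have "K \<ge> 200"
    by (simp add: K_def)
  ultimately have bound: "k + l + 150 \<le> dsize (enc_qform (And \<phi> \<chi>)) * K"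
    using k(2) l(2) by linarith
  show ?case
    unfolding K_def[symmetric]
    using M C And.prems k l k' l' m bound
    by (intro costs_progI) (simp_all add: prog_nth find_body_def Let_def enc_nat_simps)
next
  case (Forall v \<phi>)
  define K where "K = 20 * dsize (enc_clause C) + 200"
  have size: "4 * dsize (enc_qform \<phi>) + 4 * dsize (enc_nat v) + 10 \<le> M"
    using Forall.prems by (simp add: enc_nat_simps)
  obtain k where k: "call prog M f_find [enc_qform \<phi>, enc_clause C] =
      Some (enc_index_option (find_clause C \<phi>), k)" "k \<le> dsize (enc_qform \<phi>) * K"
    using Forall by (auto simp: K_def elim: costsE)
  let ?x = "enc_index_option (map_option (Cons False) (find_clause C \<phi>))"
  have sizes: "dsize ?x \<le> M" "dsize (enc_index_option (find_clause C \<phi>)) \<le> M"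
    using dsize_enc_index_option_find[of C \<phi>] size
    by (cases "find_clause C \<phi>"; simp add: enc_index_simps)+
  obtain k' where k': "call prog M f_cons_option [Atom, enc_index_option (find_clause C \<phi>)] =
      Some (?x, k')" "k' \<le> 20"
    using costs_cons_option[OF M sizes(2), of False] sizes by (auto elim: costsE)
  obtain m where m: "call prog M f_member [enc_nat v, enc_clause C] =
      Some (enc_bool (v \<in> vars C), m)" "m \<le> 20 * dsize (enc_clause C) + 20"
    using costs_member[OF M _ C, of v] size by (auto elim: costsE)
  have "dsize (enc_qform (Forall v \<phi>)) * K \<ge> dsize (enc_qform \<phi>) * K + K"
    by (simp add: algebra_simps)
  then have bound: "k + m + 150 \<le> dsize (enc_qform (Forall v \<phi>)) * K"
    using k(2) m(2) unfolding K_def by linarith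
  show ?case
    unfolding K_def[symmetric]
    using M C Forall.prems k k' m bound
    by (intro costs_progI; cases "v \<in> vars C") (simp_all add: prog_nth find_body_def Let_def enc_nat_simps)
next
  case (Exists v \<phi>)
  define K where "K = 20 * dsize (enc_clause C) + 200"
  have size: "4 * dsize (enc_qform \<phi>) + 4 * dsize (enc_nat v) + 10 \<le> M"
    using Exists.prems by (simp add: enc_nat_simps)
  obtain k where k: "call prog M f_find [enc_qform \<phi>, enc_clause C] =
      Some (enc_index_option (find_clause C \<phi>), k)" "k \<le> dsize (enc_qform \<phi>) * K"
    using Exists by (auto simp: K_def elim: costsE)
  let ?x = "enc_index_option (map_option (Cons False) (find_clause C \<phi>))"
  have sizes: "dsize ?x \<le> M" "dsize (enc_index_option (find_clause C \<phi>)) \<le> M"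
    using dsize_enc_index_option_find[of C \<phi>] size
    by (cases "find_clause C \<phi>"; simp add: enc_index_simps)+
  obtain k' where k': "call prog M f_cons_option [Atom, enc_index_option (find_clause C \<phi>)] =
      Some (?x, k')" "k' \<le> 20"
    using costs_cons_option[OF M sizes(2), of False] sizes by (auto elim: costsE)
  obtain m where m: "call prog M f_member [enc_nat v, enc_clause C] =
      Some (enc_bool (v \<in> vars C), m)" "m \<le> 20 * dsize (enc_clause C) + 20"
    using costs_member[OF M _ C, of v] size by (auto elim: costsE)
  have "dsize (enc_qform (Exists v \<phi>)) * K \<ge> dsize (enc_qform \<phi>) * K + K"
    by (simp add: algebra_simps)
  then have bound: "k + m + 150 \<le> dsize (enc_qform (Exists v \<phi>)) * K"
    using k(2) m(2) unfolding K_def by linarith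
  show ?case
    unfolding K_def[symmetric]
    using M C Exists.prems k k' m bound
    by (intro costs_progI; cases "v \<in> vars C") (simp_all add: prog_nth find_body_def Let_def enc_nat_simps)
qed

lemma dsize_enc_index_append:
  "dsize (enc_index (i @ j)) + 1 = dsize (enc_index i) + dsize (enc_index j)"
  using dsize_enc_list_append[of "map enc_bool i" "map enc_bool j"] by (simp add: enc_index_def)

lemma costs_append_index:
  assumes "20 \<le> M" "dsize (enc_index (i @ j)) \<le> M"
  shows "costs prog M f_append [enc_index i, enc_index j] (enc_index (i @ j)) (10 * length i + 10)"
  using costs_append[OF assms(1), of "map enc_bool i" "map enc_bool j"] assms(2)
  by (simp add: enc_index_def)

lemma costs_drop_index:
  assumes "20 \<le> M" "dsize (enc_index i) \<le> M" "dsize (enc_index j) \<le> M"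
  shows "costs prog M f_drop [enc_index i, enc_index j] (enc_index (drop (length i) j))
    (10 * length i + 10)"
  using costs_drop[OF assms(1), of "map enc_bool i" "map enc_bool j"] assms(2,3)
  by (simp add: enc_index_def drop_map)

lemma costs_longer_index:
  assumes "20 \<le> M" "dsize (enc_index i) \<le> M" "dsize (enc_index j) \<le> M"
  shows "costs prog M f_longer [enc_index i, enc_index j] (enc_index (longer i j))
    (10 * length i + 20)"
proof -
  have "longer (map enc_bool i) (map enc_bool j) = map enc_bool (longer i j)"
    by (simp add: longer_def)
  then show ?thesis
    using costs_longer[OF assms(1), of "map enc_bool i" "map enc_bool j"] assms(2,3)
    by (simp add: enc_index_def)
qed

section \<open>Cost of building derivations\<close>

lemma dsize_up_chain_ge: "dsize (enc_ptree t) \<le> dsize (enc_ptree (up_chain j r C t))"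
  by (induction j r C t rule: up_chain.induct) auto

lemma dsize_down_chain_ge: "dsize (enc_ptree t) \<le> dsize (enc_ptree (down_chain j r C t))"
  by (induction j r C t rule: down_chain.induct) auto

text \<open>The sum of the two lengths is invariant under the recursion although \<open>j\<close>
  grows, so one \<open>n\<close> bounds every append on the way.\<close>

lemma costs_up:
  assumes "20 \<le> M"
  shows "dsize (enc_index (j @ r)) \<le> M \<Longrightarrow> dsize (enc_clause C) \<le> M \<Longrightarrow>
    dsize (enc_ptree (up_chain j r C t)) \<le> M \<Longrightarrow> length j + length r \<le> n \<Longrightarrow>
    costs prog M f_up [enc_index j, enc_index r, enc_clause C, enc_ptree t]
      (enc_ptree (up_chain j r C t)) (length r * (10 * n + 100) + 10)"
proof (induction j r C t rule: up_chain.induct)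
  case (1 j C t)
  then show ?case
    using assms by (intro costs_progI) (simp_all add: prog_nth up_body_def enc_index_simps)
next
  case (2 j d r C t)
  have size: "dsize (enc_index (j @ [d])) \<le> M" "dsize (enc_index j) \<le> M"
      "dsize (enc_index (d # r)) \<le> M"
    using 2(2) dsize_enc_index_append[of j "d # r"] dsize_enc_index_append[of j "[d]"]
      dsize_pos[of "enc_index r"] dsize_pos[of "enc_index j"]
    by (simp_all add: enc_index_simps)
  obtain k where k: "call prog M f_append [enc_index j, Dot (enc_bool d) Atom] =
      Some (enc_index (j @ [d]), k)" "k \<le> 10 * length j + 10"
    using costs_append_index[OF assms size(1)] by (auto simp: enc_index_simps elim: costsE)
  obtain l where l: "call prog M f_up [enc_index (j @ [d]), enc_index r, enc_clause C, enc_ptree t] =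
      Some (enc_ptree (up_chain (j @ [d]) r C t), l)" "l \<le> length r * (10 * n + 100) + 10"
    using 2 by (auto elim: costsE)
  show ?case
    using assms 2(3-5) k l size dsize_up_chain_ge[of t "j @ [d]" r C] dsize_enc_bool[of d]
    by (intro costs_progI)
      (simp_all add: prog_nth up_body_def enc_index_simps enc_judgement_def enc_nat_simps)
qed

text \<open>The factor 20 in place of the 10 of upward flow arises because the extended index is
  written, and so evaluated, twice in the body.\<close>

lemma costs_down:
  assumes "20 \<le> M"
  shows "dsize (enc_index (j @ r)) \<le> M \<Longrightarrow> dsize (enc_clause C) \<le> M \<Longrightarrow>
    dsize (enc_ptree (down_chain j r C t)) \<le> M \<Longrightarrow> length j + length r \<le> n \<Longrightarrow>
    costs prog M f_down [enc_index j, enc_index r, enc_clause C, enc_ptree t]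
      (enc_ptree (down_chain j r C t)) (length r * (20 * n + 100) + 10)"
proof (induction j r C t rule: down_chain.induct)
  case (1 j C t)
  then show ?case
    using assms by (intro costs_progI) (simp_all add: prog_nth down_body_def Let_def enc_index_simps)
next
  case (2 j d r C t)
  have size: "dsize (enc_index (j @ [d])) \<le> M" "dsize (enc_index j) \<le> M"
      "dsize (enc_index (d # r)) \<le> M"
    using 2(2) dsize_enc_index_append[of j "d # r"] dsize_enc_index_append[of j "[d]"]
      dsize_pos[of "enc_index r"] dsize_pos[of "enc_index j"]
    by (simp_all add: enc_index_simps)
  let ?t = "PTree (j @ [d], C) (Down_Flow t)"
  obtain k where k: "call prog M f_append [enc_index j, Dot (enc_bool d) Atom] =
      Some (enc_index (j @ [d]), k)" "k \<le> 10 * length j + 10"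
    using costs_append_index[OF assms size(1)] by (auto simp: enc_index_simps elim: costsE)
  obtain l where l: "call prog M f_down [enc_index (j @ [d]), enc_index r, enc_clause C, enc_ptree ?t] =
      Some (enc_ptree (down_chain (j @ [d]) r C ?t), l)" "l \<le> length r * (20 * n + 100) + 10"
    using 2 by (auto elim: costsE)
  show ?case
    using assms 2(3-5) k l size dsize_down_chain_ge[of ?t "j @ [d]" r C] dsize_enc_bool[of d]
    by (intro costs_progI)
      (simp_all add: prog_nth down_body_def Let_def enc_index_simps enc_judgement_def enc_nat_simps)
qed

lemma clauses_ok_subf: "subf \<psi> i = Some \<phi> \<Longrightarrow> clauses_ok \<psi> \<Longrightarrow> clauses_ok \<phi>"
  by (induction \<psi> i rule: subf.induct) (auto split: if_splits)

lemma dsize_subf: "subf \<psi> i = Some \<phi> \<Longrightarrow> dsize (enc_qform \<phi>) \<le> dsize (enc_qform \<psi>)"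
  by (induction \<psi> i rule: subf.induct) (auto split: if_splits)

lemma dsize_enc_index_le: "length i \<le> n \<Longrightarrow> dsize (enc_index i) \<le> 4 * n + 1"
  using dsize_enc_index[of i] by linarith

lemma costs_leaf:
  assumes "4 * n + 20 \<le> M" "length (j @ r) \<le> n" "dsize (enc_clause C) \<le> M"
    and "dsize (enc_ptree (up_chain j r C (PTree (j @ r, C) By_Clause))) \<le> M"
  shows "costs prog M f_leaf [enc_index j, enc_clause C, enc_index r]
    (enc_ptree (up_chain j r C (PTree (j @ r, C) By_Clause))) (n * (10 * n + 100) + 10 * n + 50)"
proof -
  have M: "20 \<le> M" "length j + length r \<le> n"
    using assms by auto
  have ij: "dsize (enc_index (j @ r)) \<le> M" "dsize (enc_index j) \<le> M" "dsize (enc_index r) \<le> M"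
    using dsize_enc_index_le[of "j @ r" n] dsize_enc_index_le[of j n] dsize_enc_index_le[of r n] assms
    by auto
  obtain k where k: "call prog M f_append [enc_index j, enc_index r] = Some (enc_index (j @ r), k)"
    "k \<le> 10 * length j + 10"
    using costs_append_index[OF M(1) ij(1)] by (rule costsE)
  obtain l where l: "call prog M f_up [enc_index j, enc_index r, enc_clause C,
      enc_ptree (PTree (j @ r, C) By_Clause)] =
      Some (enc_ptree (up_chain j r C (PTree (j @ r, C) By_Clause)), l)"
    "l \<le> length r * (10 * n + 100) + 10"
    using costs_up[OF M(1) ij(1) assms(3,4) M(2)] by (rule costsE)
  have "length r * (10 * n + 100) \<le> n * (10 * n + 100)"
    using M by (intro mult_le_mono1) simp
  then have "k + l + 30 \<le> n * (10 * n + 100) + 10 * n + 50"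
    using k(2) l(2) M(2) by linarith
  then show ?thesis
    using M ij assms(3,4) k l dsize_up_chain_ge[of "PTree (j @ r, C) By_Clause" j r C]
    by (intro costs_progI) (simp_all add: prog_nth leaf_body_def enc_judgement_def enc_nat_simps)
qed

lemma costs_leaf_tree:
  assumes "4 * n + 20 \<le> M" "dsize (enc_qform \<psi>) \<le> n" "dsize (enc_clause C) \<le> 2 * n"
    and "clauses_ok \<psi>" "finite C"
    and "subf \<psi> j = Some \<phi>" "find_clause C \<phi> = Some (leaf_path \<psi> j C)"
    and "dsize (enc_ptree (leaf_tree \<psi> j C)) \<le> M"
  shows "costs prog M f_leaf_tree [enc_qform \<psi>, enc_index j, enc_clause C]
    (enc_ptree (leaf_tree \<psi> j C)) (200 * (n + 1)\<^sup>2)"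
proof -
  let ?r = "leaf_path \<psi> j C"
  have M: "20 \<le> M" "dsize (enc_clause C) \<le> M" "dsize (enc_qform \<psi>) \<le> M"
    using assms by auto
  have \<phi>: "clauses_ok \<phi>" "dsize (enc_qform \<phi>) \<le> n"
    using clauses_ok_subf[OF assms(6,4)] dsize_subf[OF assms(6)] assms(2) by auto
  have "subf \<psi> (j @ ?r) \<noteq> None"
    using find_clause_sound[OF assms(7)] assms(6) by (simp add: subf_append)
  then have len: "length (j @ ?r) \<le> n"
    using length_index_less[of \<psi> "j @ ?r"] assms(2) by linarith
  then have j: "dsize (enc_index j) \<le> M" "dsize (enc_index ?r) \<le> M" "length j \<le> n"
    using dsize_enc_index_le[of j n] dsize_enc_index_le[of ?r n] assms(1) by auto
  obtain k where k: "call prog M f_subf [enc_qform \<psi>, enc_index j] = Some (enc_qform \<phi>, k)"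
    "k \<le> 50 * length j + 10"
    using costs_subf[OF M(1) assms(6) M(3) j(1)] by (rule costsE)
  obtain l where l: "call prog M f_find [enc_qform \<phi>, enc_clause C] =
      Some (Dot Atom (enc_index ?r), l)"
    "l \<le> dsize (enc_qform \<phi>) * (20 * dsize (enc_clause C) + 200)"
    using costs_find[OF M(1) assms(5) M(2) \<phi>(1)] \<phi>(2) assms(1,7) by (auto elim: costsE)
  obtain m where m: "call prog M f_leaf [enc_index j, enc_clause C, enc_index ?r] =
      Some (enc_ptree (leaf_tree \<psi> j C), m)" "m \<le> n * (10 * n + 100) + 10 * n + 50"
    using costs_leaf[OF assms(1) len M(2)] assms(8) by (auto simp: leaf_tree_def elim: costsE)
  have "dsize (enc_qform \<phi>) * (20 * dsize (enc_clause C) + 200) \<le> n * (40 * n + 200)"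
    using \<phi>(2) assms(3) by (intro mult_le_mono) auto
  then have "k + l + m + 20 \<le> 200 * (n + 1)\<^sup>2"
    using k(2) l(2) m(2) j(3) by (simp add: power2_eq_square algebra_simps)
  then show ?thesis
    using M j k l m by (intro costs_progI) (simp_all add: prog_nth leaf_tree_body_def)
qed

lemma length_append_drop:
  "length i \<le> n \<Longrightarrow> length j \<le> n \<Longrightarrow> length j + length (drop (length j) i) \<le> n"
  by simp

lemma costs_removal_tree:
  assumes "4 * n + 20 \<le> M" "length i \<le> n" "length j \<le> n" "dsize (enc_clause C) \<le> M"
    and "dsize (enc_ptree (removal_tree j i C t)) \<le> M"
  shows "costs prog M f_removal_tree [enc_index j, enc_index i, enc_clause C, enc_ptree t]
    (enc_ptree (removal_tree j i C t)) (200 * (n + 1)\<^sup>2)"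
proof -
  let ?r = "drop (length j) i" and ?t = "PTree (i, C) (Forall_Removal t)"
  note len = length_append_drop[OF assms(2,3)]
  have M: "20 \<le> M" "dsize (enc_index j) \<le> M" "dsize (enc_index i) \<le> M"
      "dsize (enc_index (j @ ?r)) \<le> M"
    using assms len dsize_enc_index_le[of j n] dsize_enc_index_le[of i n]
      dsize_enc_index_le[of "j @ ?r" n] by auto
  have size: "dsize (enc_ptree ?t) \<le> M"
    using dsize_up_chain_ge[of ?t j ?r C] assms(5) by (simp add: removal_tree_def)
  obtain k where k: "call prog M f_drop [enc_index j, enc_index i] = Some (enc_index ?r, k)"
    "k \<le> 10 * length j + 10"
    using costs_drop_index[OF M(1-3)] by (rule costsE)
  obtain l where l: "call prog M f_up [enc_index j, enc_index ?r, enc_clause C, enc_ptree ?t] =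
      Some (enc_ptree (removal_tree j i C t), l)" "l \<le> length ?r * (10 * n + 100) + 10"
    using costs_up[OF M(1,4) assms(4) _ len, of ?t] assms(5)
    by (auto simp: removal_tree_def elim: costsE)
  have "length ?r * (10 * n + 100) \<le> n * (10 * n + 100)"
    using len by (intro mult_le_mono1) simp
  then have "k + l + 40 \<le> 200 * (n + 1)\<^sup>2"
    using k(2) l(2) assms(3) by (simp add: power2_eq_square algebra_simps)
  then show ?thesis
    using M k l size assms(4)
    by (intro costs_progI) (simp_all add: prog_nth removal_tree_body_def enc_judgement_def enc_nat_simps)
qed

lemma costs_lower:
  assumes "4 * n + 20 \<le> M" "length i \<le> n" "length j \<le> n" "dsize (enc_clause C) \<le> M"
    and "dsize (enc_ptree (lower j i C t)) \<le> M"
  shows "costs prog M f_lower [enc_index j, enc_index i, enc_clause C, enc_ptree t]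
    (enc_ptree (lower j i C t)) (200 * (n + 1)\<^sup>2)"
proof -
  let ?r = "drop (length j) i"
  note len = length_append_drop[OF assms(2,3)]
  have M: "20 \<le> M" "dsize (enc_index j) \<le> M" "dsize (enc_index i) \<le> M"
      "dsize (enc_index (j @ ?r)) \<le> M"
    using assms len dsize_enc_index_le[of j n] dsize_enc_index_le[of i n]
      dsize_enc_index_le[of "j @ ?r" n] by auto
  have size: "dsize (enc_ptree t) \<le> M"
    using dsize_down_chain_ge[of t j ?r C] assms(5) by (simp add: lower_def)
  obtain k where k: "call prog M f_drop [enc_index j, enc_index i] = Some (enc_index ?r, k)"
    "k \<le> 10 * length j + 10"
    using costs_drop_index[OF M(1-3)] by (rule costsE)
  obtain l where l: "call prog M f_down [enc_index j, enc_index ?r, enc_clause C, enc_ptree t] =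
      Some (enc_ptree (lower j i C t), l)" "l \<le> length ?r * (20 * n + 100) + 10"
    using costs_down[OF M(1,4) assms(4) _ len, of t] assms(5)
    by (auto simp: lower_def elim: costsE)
  have "length ?r * (20 * n + 100) \<le> n * (20 * n + 100)"
    using len by (intro mult_le_mono1) simp
  then have "k + l + 40 \<le> 200 * (n + 1)\<^sup>2"
    using k(2) l(2) assms(3) by (simp add: power2_eq_square algebra_simps)
  then show ?thesis
    using M k l size assms(4)
    by (intro costs_progI) (simp_all add: prog_nth lower_body_def)
qed

lemma costs_resolution_tree:
  assumes "4 * n + 20 \<le> M" "length i \<le> n" "length j \<le> n" "dsize (enc_clause C) \<le> M"
    and "dsize (enc_ptree (resolution_tree j i C t u)) \<le> M"
  shows "costs prog M f_resolution_tree
    [enc_index j, enc_index i, enc_clause C, enc_ptree t, enc_ptree u]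
    (enc_ptree (resolution_tree j i C t u)) (200 * (n + 1)\<^sup>2)"
proof -
  let ?r = "drop (length j) i" and ?t = "PTree (i, C) (Resolve t u)"
  note len = length_append_drop[OF assms(2,3)]
  have M: "20 \<le> M" "dsize (enc_index j) \<le> M" "dsize (enc_index i) \<le> M"
      "dsize (enc_index (j @ ?r)) \<le> M"
    using assms len dsize_enc_index_le[of j n] dsize_enc_index_le[of i n]
      dsize_enc_index_le[of "j @ ?r" n] by auto
  have size: "dsize (enc_ptree ?t) \<le> M"
    using dsize_up_chain_ge[of ?t j ?r C] assms(5) by (simp add: resolution_tree_def)
  obtain k where k: "call prog M f_drop [enc_index j, enc_index i] = Some (enc_index ?r, k)"
    "k \<le> 10 * length j + 10"
    using costs_drop_index[OF M(1-3)] by (rule costsE)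
  obtain l where l: "call prog M f_up [enc_index j, enc_index ?r, enc_clause C, enc_ptree ?t] =
      Some (enc_ptree (resolution_tree j i C t u), l)" "l \<le> length ?r * (10 * n + 100) + 10"
    using costs_up[OF M(1,4) assms(4) _ len, of ?t] assms(5)
    by (auto simp: resolution_tree_def elim: costsE)
  have "length ?r * (10 * n + 100) \<le> n * (10 * n + 100)"
    using len by (intro mult_le_mono1) simp
  then have "k + l + 40 \<le> 200 * (n + 1)\<^sup>2"
    using k(2) l(2) assms(3) by (simp add: power2_eq_square algebra_simps)
  then show ?thesis
    using M k l size assms(4)
    by (intro costs_progI) (simp_all add: prog_nth resolution_tree_body_def enc_judgement_def enc_nat_simps)
qed

lemma dsize_removal_tree_ge: "dsize (enc_ptree t) \<le> dsize (enc_ptree (removal_tree j i C t))"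
  using dsize_up_chain_ge[of "PTree (i, C) (Forall_Removal t)" j "drop (length j) i" C]
  by (simp add: removal_tree_def)

lemma dsize_lower_ge: "dsize (enc_ptree t) \<le> dsize (enc_ptree (lower j i C t))"
  by (simp add: lower_def dsize_down_chain_ge)

lemma dsize_resolution_tree_ge:
  "dsize (enc_ptree t) \<le> dsize (enc_ptree (resolution_tree j i C t u))"
  "dsize (enc_ptree u) \<le> dsize (enc_ptree (resolution_tree j i C t u))"
  using dsize_up_chain_ge[of "PTree (i, C) (Resolve t u)" j "drop (length j) i" C]
  by (simp_all add: resolution_tree_def)

definition branch_tree ::
    "index \<Rightarrow> index \<Rightarrow> index \<Rightarrow> clause \<Rightarrow> clause \<Rightarrow> clause \<Rightarrow> ptree \<Rightarrow> ptree \<Rightarrow> ptree" where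
  "branch_tree j j0 j1 C C0 C1 t u =
     resolution_tree j (longer j0 j1) C (lower j0 (longer j0 j1) C0 t) (lower j1 (longer j0 j1) C1 u)"

lemma costs_branch:
  assumes "4 * n + 20 \<le> M" "length j \<le> n" "length j0 \<le> n" "length j1 \<le> n"
    and "dsize (enc_clause C) \<le> M" "dsize (enc_clause C0) \<le> M" "dsize (enc_clause C1) \<le> M"
    and "dsize (enc_ptree (branch_tree j j0 j1 C C0 C1 t u)) \<le> M"
  shows "costs prog M f_branch
    [enc_index j, enc_index j0, enc_index j1, enc_clause C, enc_clause C0, enc_clause C1,
     enc_ptree t, enc_ptree u]
    (enc_ptree (branch_tree j j0 j1 C C0 C1 t u)) (1000 * (n + 1)\<^sup>2)"
proof -
  define i where "i = longer j0 j1"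
  have i: "length i \<le> n"
    using assms by (simp add: i_def longer_def)
  have M: "20 \<le> M" "dsize (enc_index j) \<le> M" "dsize (enc_index j0) \<le> M" "dsize (enc_index j1) \<le> M"
    using assms dsize_enc_index_le[of j n] dsize_enc_index_le[of j0 n] dsize_enc_index_le[of j1 n]
    by auto
  let ?t = "lower j0 i C0 t" and ?u = "lower j1 i C1 u"
  have res: "branch_tree j j0 j1 C C0 C1 t u = resolution_tree j i C ?t ?u"
    by (simp add: branch_tree_def i_def)
  then have size: "dsize (enc_ptree ?t) \<le> M" "dsize (enc_ptree ?u) \<le> M"
      "dsize (enc_ptree (resolution_tree j i C ?t ?u)) \<le> M"
    using assms(8) dsize_resolution_tree_ge[of ?t j i C ?u] dsize_resolution_tree_ge[of ?u j i C ?t]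
      dsize_resolution_tree_ge(2)[of ?u j i C ?t] by auto
  then have size': "dsize (enc_ptree t) \<le> M" "dsize (enc_ptree u) \<le> M"
    using dsize_lower_ge[of t j0 i C0] dsize_lower_ge[of u j1 i C1] by auto
  obtain k where k: "call prog M f_longer [enc_index j0, enc_index j1] = Some (enc_index i, k)"
    "k \<le> 10 * length j0 + 20"
    using costs_longer_index[OF M(1,3,4)] by (auto simp: i_def elim: costsE)
  obtain l where l: "call prog M f_lower [enc_index j0, enc_index i, enc_clause C0, enc_ptree t] =
      Some (enc_ptree ?t, l)" "l \<le> 200 * (n + 1)\<^sup>2"
    using costs_lower[OF assms(1) i assms(3,6) size(1)] by (rule costsE)
  obtain m where m: "call prog M f_lower [enc_index j1, enc_index i, enc_clause C1, enc_ptree u] =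
      Some (enc_ptree ?u, m)" "m \<le> 200 * (n + 1)\<^sup>2"
    using costs_lower[OF assms(1) i assms(4,7) size(2)] by (rule costsE)
  obtain p where p: "call prog M f_resolution_tree
      [enc_index j, enc_index i, enc_clause C, enc_ptree ?t, enc_ptree ?u] =
      Some (enc_ptree (resolution_tree j i C ?t ?u), p)" "p \<le> 200 * (n + 1)\<^sup>2"
    using costs_resolution_tree[OF assms(1) i assms(2,5) size(3)] by (rule costsE)
  \<comment> \<open>The factor 3 counts the evaluations of \<open>i\<close> in
    \<open>branch_body\<close>.\<close>
  have "3 * k + 100 \<le> 200 * (n + 1)\<^sup>2"
    using k(2) assms(3) by (simp add: power2_eq_square algebra_simps)
  then have "3 * k + l + m + p + 60 \<le> 1000 * (n + 1)\<^sup>2"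
    using l(2) m(2) p(2) by linarith
  then show ?thesis
    using M k l m p size size' assms(5-7) res
    by (intro costs_progI) (simp_all add: prog_nth branch_body_def Let_def)
qed

section \<open>Cost of translating a trace\<close>

lemma label_ok_indices:
  assumes "label_ok \<psi> S a"
  shows "loc S \<in> indices \<psi>" "body_loc S \<in> indices \<psi>"
proof -
  have "[] \<in> indices \<psi>"
    by (simp add: indices_def)
  moreover have "located \<psi> (Max S)" if "S \<noteq> {}"
    using assms label_ok_finite[OF assms] that by (auto simp: label_ok_def)
  ultimately show "loc S \<in> indices \<psi>" "body_loc S \<in> indices \<psi>"
    using located_indices located_body_indices by (auto simp: loc_def body_loc_def)
qed

lemma dfst_enc_trace:
  "dfst (enc_trace t) = enc_set enc_locvar (trace_set t)"
  "dfst (dsnd (enc_trace t)) = enc_assignment (snd (label t))"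
  by (cases t; simp)+

lemma dsize_trace_parts:
  "dsize (enc_set enc_locvar (trace_set t)) \<le> dsize (enc_trace t)"
  "dsize (enc_assignment (snd (label t))) \<le> dsize (enc_trace t)"
  by (cases t; simp)+

lemma dsize_falsified_clause:
  "finite (dom a) \<Longrightarrow> dsize (enc_clause (falsified_clause a)) \<le> 2 * dsize (enc_assignment a)"
  using costs_clause(1)[of "20 + 2 * dsize (enc_assignment a)" a] by simp

lemma trace_bounds:
  assumes "is_trace \<psi> t" "dsize (enc_qform \<psi>) \<le> n" "dsize (enc_trace t) \<le> n"
  shows "length (loc (trace_set t)) \<le> n" "length (body_loc (trace_set t)) \<le> n"
    and "finite (trace_clause t)" "dsize (enc_clause (trace_clause t)) \<le> 2 * n"
proof -
  have ok: "label_ok \<psi> (trace_set t) (snd (label t))"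
    using is_trace_label_ok[OF assms(1)] by (metis prod.collapse)
  show "length (loc (trace_set t)) \<le> n" "length (body_loc (trace_set t)) \<le> n"
    using label_ok_indices[OF ok] length_index_less[of \<psi>] assms(2)
    by (fastforce simp: indices_def intro: order.trans less_imp_le)+
  show "finite (trace_clause t)" "dsize (enc_clause (trace_clause t)) \<le> 2 * n"
    using label_ok_finite_dom[OF ok] dsize_falsified_clause[of "snd (label t)"]
      dsize_trace_parts(2)[of t] assms(3) is_clause_falsified_clause[of "snd (label t)"]
    by (auto simp: is_clause_def)
qed

lemma trace_calls:
  assumes "is_trace \<psi> t" "dsize (enc_qform \<psi>) \<le> n" "dsize (enc_trace t) \<le> n" "8 * n + 20 \<le> M"
  shows "costs prog M f_loc [enc_set enc_locvar (trace_set t)] (enc_index (loc (trace_set t)))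
      (20 * n + 20)"
    and "costs prog M f_body_loc [enc_set enc_locvar (trace_set t)]
      (enc_index (body_loc (trace_set t))) (30 * n + 50)"
    and "costs prog M f_clause [enc_assignment (snd (label t))] (enc_clause (trace_clause t))
      (20 * n + 20)"
proof -
  have ok: "label_ok \<psi> (trace_set t) (snd (label t))"
    using is_trace_label_ok[OF assms(1)] by (metis prod.collapse)
  note fin = label_ok_finite[OF ok] label_ok_finite_dom[OF ok]
  note len = trace_bounds[OF assms(1-3)]
  have M: "20 \<le> M" "dsize (enc_set enc_locvar (trace_set t)) \<le> M"
      "2 * dsize (enc_assignment (snd (label t))) \<le> M" "dsize (enc_index (body_loc (trace_set t))) \<le> M"
    using assms(3,4) dsize_trace_parts[of t] len dsize_enc_index_le[of "body_loc (trace_set t)" n]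
    by auto
  show "costs prog M f_loc [enc_set enc_locvar (trace_set t)] (enc_index (loc (trace_set t)))
      (20 * n + 20)"
    using costs_loc[OF M(1) fin(1) M(2)] dsize_trace_parts(1)[of t] assms(3)
    by (auto elim: costs_mono)
  show "costs prog M f_body_loc [enc_set enc_locvar (trace_set t)]
      (enc_index (body_loc (trace_set t))) (30 * n + 50)"
    using costs_body_loc[OF M(1) fin(1) M(2,4)] dsize_trace_parts(1)[of t] assms(3) len(2)
    by (auto elim: costs_mono)
  show "costs prog M f_clause [enc_assignment (snd (label t))] (enc_clause (trace_clause t))
      (20 * n + 20)"
    using costs_clause(2)[OF M(1) fin(2) M(3)] dsize_trace_parts(2)[of t] assms(3)
    by (auto elim: costs_mono)
qed

text \<open>Separated from the induction because it is needed for both listings of the children. The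
  last two hypotheses have the shape of induction hypotheses; their premises hold since lowering and
  resolving only enlarge a derivation.\<close>

lemma costs_translate_two:
  assumes "is_trace \<psi> (TNode S a [t, u])" "is_trace \<psi> t" "is_trace \<psi> u"
    and "dsize (enc_qform \<psi>) \<le> n" "8 * n + 20 \<le> M"
    and "dsize (enc_trace (TNode S a [t, u])) \<le> n"
    and "dsize (enc_ptree (translate \<psi> (TNode S a [t, u]))) \<le> M"
    and t: "dsize (enc_ptree (translate \<psi> t)) \<le> M \<Longrightarrow>
      costs prog M f_translate [enc_qform \<psi>, enc_trace t] (enc_ptree (translate \<psi> t)) k"
    and u: "dsize (enc_ptree (translate \<psi> u)) \<le> M \<Longrightarrow>
      costs prog M f_translate [enc_qform \<psi>, enc_trace u] (enc_ptree (translate \<psi> u)) l"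
  shows "costs prog M f_translate [enc_qform \<psi>, enc_trace (TNode S a [t, u])]
    (enc_ptree (translate \<psi> (TNode S a [t, u]))) (2000 * (n + 1)\<^sup>2 + k + l)"
proof -
  have n: "dsize (enc_trace t) \<le> n" "dsize (enc_trace u) \<le> n"
    using assms(6) by auto
  have M: "4 * n + 20 \<le> M" "20 \<le> M" "2 * n \<le> M"
    using assms(5) by auto
  note bS = trace_bounds[OF assms(1,4,6), simplified] and bt = trace_bounds[OF assms(2,4) n(1)]
    and bu = trace_bounds[OF assms(3,4) n(2)]
  note cS = trace_calls[OF assms(1,4,6,5), simplified] and ct = trace_calls[OF assms(2,4) n(1) assms(5)]
    and cu = trace_calls[OF assms(3,4) n(2) assms(5)]
  let ?j = "body_loc S" and ?jt = "body_loc (trace_set t)" and ?ju = "body_loc (trace_set u)"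
  let ?C = "falsified_clause a"
  have tree: "translate \<psi> (TNode S a [t, u]) = branch_tree ?j ?jt ?ju ?C (trace_clause t)
      (trace_clause u) (translate \<psi> t) (translate \<psi> u)"
    by (simp add: branch_tree_def Let_def)
  have clauses: "dsize (enc_clause ?C) \<le> M" "dsize (enc_clause (trace_clause t)) \<le> M"
      "dsize (enc_clause (trace_clause u)) \<le> M"
    using bS(4) bt(4) bu(4) M(3) by auto
  have sizes: "dsize (enc_ptree (translate \<psi> t)) \<le> M" "dsize (enc_ptree (translate \<psi> u)) \<le> M"
    using assms(7) unfolding tree branch_tree_def
    by (rule order.trans[OF order.trans[OF dsize_lower_ge dsize_resolution_tree_ge(1)]],
        rule order.trans[OF order.trans[OF dsize_lower_ge dsize_resolution_tree_ge(2)]])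
  obtain k' where
    "call prog M f_translate [enc_qform \<psi>, enc_trace t] = Some (enc_ptree (translate \<psi> t), k')" "k' \<le> k"
    using t[OF sizes(1)] by (rule costsE)
  moreover obtain l' where
    "call prog M f_translate [enc_qform \<psi>, enc_trace u] = Some (enc_ptree (translate \<psi> u), l')" "l' \<le> l"
    using u[OF sizes(2)] by (rule costsE)
  moreover obtain b where "call prog M f_branch
      [enc_index ?j, enc_index ?jt, enc_index ?ju, enc_clause ?C, enc_clause (trace_clause t),
       enc_clause (trace_clause u), enc_ptree (translate \<psi> t), enc_ptree (translate \<psi> u)] =
      Some (enc_ptree (translate \<psi> (TNode S a [t, u])), b)" "b \<le> 1000 * (n + 1)\<^sup>2"
    using costs_branch[OF M(1) bS(2) bt(2) bu(2) clauses assms(7)[unfolded tree]] unfolding tree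
    by (rule costsE)
  moreover obtain k1 where
    "call prog M f_body_loc [enc_set enc_locvar S] = Some (enc_index ?j, k1)" "k1 \<le> 30 * n + 50"
    using cS(2) by (rule costsE)
  moreover obtain k2 where
    "call prog M f_body_loc [enc_set enc_locvar (trace_set t)] = Some (enc_index ?jt, k2)"
    "k2 \<le> 30 * n + 50"
    using ct(2) by (rule costsE)
  moreover obtain k3 where
    "call prog M f_body_loc [enc_set enc_locvar (trace_set u)] = Some (enc_index ?ju, k3)"
    "k3 \<le> 30 * n + 50"
    using cu(2) by (rule costsE)
  moreover obtain l1 where
    "call prog M f_clause [enc_assignment a] = Some (enc_clause ?C, l1)" "l1 \<le> 20 * n + 20"
    using cS(3) by (rule costsE)
  moreover obtain l2 where
    "call prog M f_clause [enc_assignment (snd (label t))] = Some (enc_clause (trace_clause t), l2)"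
    "l2 \<le> 20 * n + 20"
    using ct(3) by (rule costsE)
  moreover obtain l3 where
    "call prog M f_clause [enc_assignment (snd (label u))] = Some (enc_clause (trace_clause u), l3)"
    "l3 \<le> 20 * n + 20"
    using cu(3) by (rule costsE)
  moreover have "200 * n + 400 \<le> 1000 * (n + 1)\<^sup>2"
    by (simp add: power2_eq_square algebra_simps)
  ultimately show ?thesis
    using M assms(4-6)
    by (intro costs_progI)
      (simp_all add: prog_nth translate_body_def Let_def dfst_enc_trace del: translate.simps)
qed

text \<open>\<open>n\<close> and \<open>M\<close> stay at the global bounds throughout the
  induction, so every node is charged the same amount for its own work and the costs of the children
  simply add up.\<close>

lemma costs_translate:
  assumes "is_trace \<psi> t" "clauses_ok \<psi>" "dsize (enc_qform \<psi>) \<le> n" "8 * n + 20 \<le> M"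
    and "dsize (enc_trace t) \<le> n" "dsize (enc_ptree (translate \<psi> t)) \<le> M"
  shows "costs prog M f_translate [enc_qform \<psi>, enc_trace t] (enc_ptree (translate \<psi> t))
    (nodes t * (2000 * (n + 1)\<^sup>2))"
  using assms(1,5,6)
proof (induction rule: is_trace.induct)
  case (leaf S a i \<alpha>)
  have "is_trace \<psi> (TNode S a [])"
    using leaf.hyps by (rule is_trace.leaf)
  note b = trace_bounds[OF this assms(3) leaf.prems(1), simplified]
    and c = trace_calls[OF this assms(3) leaf.prems(1) assms(4), simplified]
  have M: "4 * n + 20 \<le> M" "20 \<le> M"
    using assms(4) by auto
  let ?j = "body_loc S" and ?C = "falsified_clause a"
  obtain \<phi> where \<phi>: "subf \<psi> ?j = Some \<phi>" "find_clause ?C \<phi> = Some (leaf_path \<psi> ?j ?C)"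
    using leaf_path_correct(1)[OF leaf.hyps] by blast
  obtain k where "call prog M f_leaf_tree [enc_qform \<psi>, enc_index ?j, enc_clause ?C] =
      Some (enc_ptree (leaf_tree \<psi> ?j ?C), k)" "k \<le> 200 * (n + 1)\<^sup>2"
    using costs_leaf_tree[OF M(1) assms(3) b(4) assms(2) b(3) \<phi>] leaf.prems(2)
    by (auto elim: costsE)
  moreover obtain l where
    "call prog M f_body_loc [enc_set enc_locvar S] = Some (enc_index ?j, l)" "l \<le> 30 * n + 50"
    using c(2) by (rule costsE)
  moreover obtain m where
    "call prog M f_clause [enc_assignment a] = Some (enc_clause ?C, m)" "m \<le> 20 * n + 20"
    using c(3) by (rule costsE)
  moreover have "200 * n + 400 \<le> 1000 * (n + 1)\<^sup>2"
    by (simp add: power2_eq_square algebra_simps)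
  ultimately show ?case
    using M assms(3,4) leaf.prems
    by (intro costs_progI) (simp_all add: prog_nth translate_body_def Let_def)
next
  case (one S a t i y b)
  have tr: "is_trace \<psi> (TNode S a [t])"
    using one.hyps by (rule is_trace.one)
  have n: "dsize (enc_trace t) \<le> n"
    using one.prems(1) by auto
  note bS = trace_bounds[OF tr assms(3) one.prems(1), simplified]
    and cS = trace_calls[OF tr assms(3) one.prems(1) assms(4), simplified]
    and bt = trace_bounds[OF one.hyps(2) assms(3) n]
    and ct = trace_calls[OF one.hyps(2) assms(3) n assms(4)]
  have M: "4 * n + 20 \<le> M" "20 \<le> M" "dsize (enc_clause (falsified_clause a)) \<le> M"
    using assms(4) bS(4) by auto
  let ?j = "body_loc S" and ?i = "loc (trace_set t)" and ?C = "falsified_clause a"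
  have size: "dsize (enc_ptree (removal_tree ?j ?i ?C (translate \<psi> t))) \<le> M"
    using one.prems(2) by simp
  then have "dsize (enc_ptree (translate \<psi> t)) \<le> M"
    using dsize_removal_tree_ge order.trans by blast
  then obtain k where
    "call prog M f_translate [enc_qform \<psi>, enc_trace t] = Some (enc_ptree (translate \<psi> t), k)"
    "k \<le> nodes t * (2000 * (n + 1)\<^sup>2)"
    using one.IH n by (auto elim: costsE)
  moreover obtain k' where
    "call prog M f_removal_tree [enc_index ?j, enc_index ?i, enc_clause ?C, enc_ptree (translate \<psi> t)] =
      Some (enc_ptree (removal_tree ?j ?i ?C (translate \<psi> t)), k')" "k' \<le> 200 * (n + 1)\<^sup>2"
    using costs_removal_tree[OF M(1) bt(1) bS(2) M(3) size] by (rule costsE)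
  moreover obtain l where
    "call prog M f_body_loc [enc_set enc_locvar S] = Some (enc_index ?j, l)" "l \<le> 30 * n + 50"
    using cS(2) by (rule costsE)
  moreover obtain l' where
    "call prog M f_loc [enc_set enc_locvar (trace_set t)] = Some (enc_index ?i, l')" "l' \<le> 20 * n + 20"
    using ct(1) by (rule costsE)
  moreover obtain m where
    "call prog M f_clause [enc_assignment a] = Some (enc_clause ?C, m)" "m \<le> 20 * n + 20"
    using cS(3) by (rule costsE)
  moreover have "200 * n + 400 \<le> 1000 * (n + 1)\<^sup>2"
    by (simp add: power2_eq_square algebra_simps)
  ultimately show ?case
    using M assms(3,4) one.prems
    by (intro costs_progI) (simp_all add: prog_nth translate_body_def Let_def dfst_enc_trace)
next
  case (two S a t0 t1 i u S0 S1 ts)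
  have tr: "is_trace \<psi> (TNode S a ts)"
    using two.hyps by (rule is_trace.two)
  have IH0: "costs prog M f_translate [enc_qform \<psi>, enc_trace t0] (enc_ptree (translate \<psi> t0))
      (nodes t0 * (2000 * (n + 1)\<^sup>2))" if "dsize (enc_ptree (translate \<psi> t0)) \<le> M"
    using two.IH(1)[OF _ that] two.prems(1) two.hyps(12) by auto
  have IH1: "costs prog M f_translate [enc_qform \<psi>, enc_trace t1] (enc_ptree (translate \<psi> t1))
      (nodes t1 * (2000 * (n + 1)\<^sup>2))" if "dsize (enc_ptree (translate \<psi> t1)) \<le> M"
    using two.IH(2)[OF _ that] two.prems(1) two.hyps(12) by auto
  from two.hyps(12) show ?case
  proof
    assume ts: "ts = [t0, t1]"
    show ?thesis
      using costs_translate_two[OF tr[unfolded ts] two.hyps(2,3) assms(3,4)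
          two.prems[unfolded ts] IH0 IH1]
      by (simp add: ts algebra_simps del: translate.simps)
  next
    assume ts: "ts = [t1, t0]"
    show ?thesis
      using costs_translate_two[OF tr[unfolded ts] two.hyps(3,2) assms(3,4)
          two.prems[unfolded ts] IH1 IH0]
      by (simp add: ts algebra_simps del: translate.simps)
  qed
qed

section \<open>Size of the output\<close>

lemma dsize_up_chain_le:
  "length j + length r \<le> n \<Longrightarrow> dsize (enc_ptree (up_chain j r C t)) \<le>
     dsize (enc_ptree t) + length r * (4 * n + dsize (enc_clause C) + 20)"
proof (induction j r C t rule: up_chain.induct)
  case (2 j d r C t)
  then show ?case
    using dsize_enc_index_le[of j n] by (simp add: enc_judgement_def enc_nat_simps)
qed simp

lemma dsize_down_chain_le:
  "length j + length r \<le> n \<Longrightarrow> dsize (enc_ptree (down_chain j r C t)) \<le>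
     dsize (enc_ptree t) + length r * (4 * n + dsize (enc_clause C) + 20)"
proof (induction j r C t rule: down_chain.induct)
  case (2 j d r C t)
  then show ?case
    using dsize_enc_index_le[of "j @ [d]" n] by (simp add: enc_judgement_def enc_nat_simps)
qed simp

text \<open>For a chain of \<open>m\<close> flow judgements on a clause of size \<open>c\<close>;
  the summand \<open>6 * n + 20\<close> leaves room for the judgement at which the chain starts. The
  left side is at most \<open>6 * n\<^sup>2 + 26 * n + 20\<close>.\<close>

lemma chain_bound:
  fixes m n c :: nat
  assumes "m \<le> n" "c \<le> 2 * n"
  shows "m * (4 * n + c + 20) + 6 * n + 20 \<le> 30 * (n + 1)\<^sup>2"
proof -
  have "m * (4 * n + c + 20) \<le> n * (6 * n + 20)"
    using assms by (intro mult_le_mono) auto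
  then show ?thesis
    by (simp add: power2_eq_square algebra_simps)
qed

lemma dsize_leaf_tree_le:
  assumes "length (j @ leaf_path \<psi> j C) \<le> n" "dsize (enc_clause C) \<le> 2 * n"
  shows "dsize (enc_ptree (leaf_tree \<psi> j C)) \<le> 30 * (n + 1)\<^sup>2"
  using assms dsize_up_chain_le[of j "leaf_path \<psi> j C" n C "PTree (j @ leaf_path \<psi> j C, C) By_Clause"]
    chain_bound[of "length (leaf_path \<psi> j C)" n "dsize (enc_clause C)"]
    dsize_enc_index_le[of "j @ leaf_path \<psi> j C" n]
  by (simp add: leaf_tree_def enc_judgement_def enc_nat_simps)

lemma dsize_removal_tree_le:
  assumes "length j \<le> n" "length i \<le> n" "dsize (enc_clause C) \<le> 2 * n"
  shows "dsize (enc_ptree (removal_tree j i C t)) \<le> dsize (enc_ptree t) + 30 * (n + 1)\<^sup>2"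
  using assms(3) dsize_up_chain_le[OF length_append_drop[OF assms(2,1)], of C
      "PTree (i, C) (Forall_Removal t)"]
    chain_bound[OF le_trans[OF diff_le_self assms(2)] assms(3), of "length j"]
    dsize_enc_index_le[OF assms(2)]
  by (simp add: removal_tree_def enc_judgement_def enc_nat_simps)

lemma dsize_lower_le:
  assumes "length j \<le> n" "length i \<le> n" "dsize (enc_clause C) \<le> 2 * n"
  shows "dsize (enc_ptree (lower j i C t)) \<le> dsize (enc_ptree t) + 30 * (n + 1)\<^sup>2"
  using dsize_down_chain_le[OF length_append_drop[OF assms(2,1)], of C t]
    chain_bound[OF le_trans[OF diff_le_self assms(2)] assms(3), of "length j"]
  by (simp add: lower_def)

lemma dsize_resolution_tree_le:
  assumes "length j \<le> n" "length i \<le> n" "dsize (enc_clause C) \<le> 2 * n"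
  shows "dsize (enc_ptree (resolution_tree j i C t u)) \<le>
    dsize (enc_ptree t) + dsize (enc_ptree u) + 30 * (n + 1)\<^sup>2"
  using assms(3) dsize_up_chain_le[OF length_append_drop[OF assms(2,1)], of C
      "PTree (i, C) (Resolve t u)"]
    chain_bound[OF le_trans[OF diff_le_self assms(2)] assms(3), of "length j"]
    dsize_enc_index_le[OF assms(2)]
  by (simp add: resolution_tree_def enc_judgement_def enc_nat_simps)

text \<open>A branching contributes most: two downward chains and one upward chain, each estimated
  with the constant 30, which 100 covers.\<close>

lemma dsize_translate:
  assumes "is_trace \<psi> t" "dsize (enc_qform \<psi>) \<le> n" "dsize (enc_trace t) \<le> n"
  shows "dsize (enc_ptree (translate \<psi> t)) \<le> nodes t * (100 * (n + 1)\<^sup>2)"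
  using assms(1,3)
proof (induction rule: is_trace.induct)
  case (leaf S a i \<alpha>)
  have "is_trace \<psi> (TNode S a [])"
    using leaf.hyps by (rule is_trace.leaf)
  note b = trace_bounds[OF this assms(2) leaf.prems(1), simplified]
  let ?i = "body_loc S @ leaf_path \<psi> (body_loc S) (falsified_clause a)"
  have "length ?i \<le> n"
    using leaf_path_correct(2)[OF leaf.hyps] length_index_less[of \<psi> ?i] assms(2) by simp
  then show ?case
    using dsize_leaf_tree_le[of "body_loc S" \<psi> "falsified_clause a" n] b(4) by simp
next
  case (one S a t i y b)
  have tr: "is_trace \<psi> (TNode S a [t])"
    using one.hyps by (rule is_trace.one)
  have n: "dsize (enc_trace t) \<le> n"
    using one.prems(1) by auto
  note bS = trace_bounds[OF tr assms(2) one.prems(1), simplified]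
    and bt = trace_bounds[OF one.hyps(2) assms(2) n]
  show ?case
    using dsize_removal_tree_le[OF bS(2) bt(1) bS(4), of "translate \<psi> t"] one.IH[OF n] by simp
next
  case (two S a t0 t1 i u S0 S1 ts)
  have tr: "is_trace \<psi> (TNode S a ts)"
    using two.hyps by (rule is_trace.two)
  have n: "dsize (enc_trace t0) \<le> n" "dsize (enc_trace t1) \<le> n"
    using two.prems two.hyps(12) by auto
  have main: "dsize (enc_ptree (translate \<psi> (TNode S a [t, u]))) \<le>
      dsize (enc_ptree (translate \<psi> t)) + dsize (enc_ptree (translate \<psi> u)) + 100 * (n + 1)\<^sup>2"
    if t: "is_trace \<psi> t" "dsize (enc_trace t) \<le> n" and u: "is_trace \<psi> u" "dsize (enc_trace u) \<le> n"
    for t u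
  proof -
    note bS = trace_bounds[OF tr assms(2) two.prems(1), simplified]
      and bt = trace_bounds[OF t(1) assms(2) t(2)] and bu = trace_bounds[OF u(1) assms(2) u(2)]
    define l where "l = longer (body_loc (trace_set t)) (body_loc (trace_set u))"
    have l: "length l \<le> n"
      using bt(2) bu(2) by (simp add: l_def longer_def)
    show ?thesis
      using dsize_lower_le[OF bt(2) l bt(4), of "translate \<psi> t"]
        dsize_lower_le[OF bu(2) l bu(4), of "translate \<psi> u"]
        dsize_resolution_tree_le[OF bS(2) l bS(4),
          of "lower (body_loc (trace_set t)) l (trace_clause t) (translate \<psi> t)"
            "lower (body_loc (trace_set u)) l (trace_clause u) (translate \<psi> u)"]
      by (simp add: Let_def flip: l_def)
  qed
  from two.hyps(12) show ?case
    using main[OF two.hyps(2) n(1) two.hyps(3) n(2)] main[OF two.hyps(3) n(2) two.hyps(2) n(1)]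
      two.IH n by (auto simp: add_mult_distrib simp del: translate.simps)
qed

lemma nodes_le_dsize: "nodes t \<le> dsize (enc_trace t)"
proof (induction t rule: nodes.induct)
  case (1 S a ts)
  have "sum_list (map nodes ts) \<le> dsize (enc_list (map enc_trace ts))"
    using 1 by (induction ts) fastforce+
  then show ?case
    by simp
qed

section \<open>The polynomial time bound\<close>

lemma costs_main:
  assumes "is_trace \<psi> T" "clauses_ok \<psi>" "n = dsize (enc_input (\<psi>, T))"
    and "8 * n + 20 \<le> M" "dsize (enc_ptree (translate \<psi> T)) \<le> M"
  shows "costs prog M 0 [enc_input (\<psi>, T)] (enc_ptree (translate \<psi> T))
    (n * (2000 * (n + 1)\<^sup>2) + 10)"
proof -
  have n: "dsize (enc_qform \<psi>) \<le> n" "dsize (enc_trace T) \<le> n"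
    using assms(3) by (simp_all add: enc_input_def)
  obtain k where k: "call prog M f_translate [enc_qform \<psi>, enc_trace T] =
      Some (enc_ptree (translate \<psi> T), k)" "k \<le> nodes T * (2000 * (n + 1)\<^sup>2)"
    using costs_translate[OF assms(1,2) n(1) assms(4) n(2) assms(5)] by (rule costsE)
  have "nodes T * (2000 * (n + 1)\<^sup>2) \<le> n * (2000 * (n + 1)\<^sup>2)"
    using nodes_le_dsize[of T] n(2) by (intro mult_le_mono1) simp
  then have "k \<le> n * (2000 * (n + 1)\<^sup>2)"
    using k(2) by linarith
  then show ?thesis
    using k(1) assms(3,4)
    by (intro costs_progI) (simp_all add: prog_nth main_body_def enc_input_def)
qed

text \<open>Step count times value bound. Both factors are cubic, with constants 8010 and 428 after
  rounding, and \<open>8010 * 428\<close> is below 4000000.\<close>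

lemma polynomial_bound:
  fixes n :: nat
  assumes "1 \<le> n"
  shows "(n * (2000 * (n + 1)\<^sup>2) + 10) * (8 * n + 20 + n * (100 * (n + 1)\<^sup>2)) \<le> 4000000 * n ^ 6"
proof -
  have "(n + 1)\<^sup>2 \<le> (2 * n)\<^sup>2"
    using assms by (intro power_mono) auto
  then have sq: "(n + 1)\<^sup>2 \<le> 4 * n\<^sup>2"
    by (simp add: power_mult_distrib)
  have pos: "1 \<le> n ^ 3" "n \<le> n ^ 3"
    using assms by (auto intro: self_le_power)
  have n3: "n * n\<^sup>2 = n ^ 3"
    by (simp add: power_numeral_reduce)
  have "n * (n + 1)\<^sup>2 \<le> 4 * n ^ 3"
    using mult_le_mono2[OF sq, of n] by (simp only: mult.left_commute[of n 4] n3)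
  then have "n * (2000 * (n + 1)\<^sup>2) \<le> 8000 * n ^ 3" "n * (100 * (n + 1)\<^sup>2) \<le> 400 * n ^ 3"
    by simp_all
  then have "n * (2000 * (n + 1)\<^sup>2) + 10 \<le> 8010 * n ^ 3"
      "8 * n + 20 + n * (100 * (n + 1)\<^sup>2) \<le> 428 * n ^ 3"
    using pos by linarith+
  then have "(n * (2000 * (n + 1)\<^sup>2) + 10) * (8 * n + 20 + n * (100 * (n + 1)\<^sup>2)) \<le>
      (8010 * n ^ 3) * (428 * n ^ 3)"
    by (rule mult_le_mono)
  also have "\<dots> \<le> 4000000 * (n ^ 3 * n ^ 3)"
    by simp
  finally show ?thesis
    by (simp flip: power_add)
qed

lemma translate_polytime:
  "polytime_computable_on {(\<psi>, T). qcbf \<psi> \<and> is_trace \<psi> T \<and> label T = ({}, Map.empty)}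
    enc_input enc_ptree (\<lambda>(\<psi>, T). translate \<psi> T)"
proof -
  have "\<exists>t. runs prog (enc_input (\<psi>, T)) (enc_ptree (translate \<psi> T)) t \<and>
      t \<le> 4000000 * dsize (enc_input (\<psi>, T)) ^ 6 + 4000000"
    if trace: "qcbf \<psi>" "is_trace \<psi> T" for \<psi> T
  proof -
    define n where "n = dsize (enc_input (\<psi>, T))"
    \<comment> \<open>The first two summands cover the input, the indices, the clauses and the
      search results; the last one bounds the output and thereby all derivations built on the
      way.\<close>
    define M where "M = 8 * n + 20 + n * (100 * (n + 1)\<^sup>2)"
    have n: "dsize (enc_qform \<psi>) \<le> n" "dsize (enc_trace T) \<le> n" "1 \<le> n"
      using dsize_pos by (simp_all add: n_def enc_input_def)
    have "nodes T * (100 * (n + 1)\<^sup>2) \<le> n * (100 * (n + 1)\<^sup>2)"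
      using nodes_le_dsize[of T] n(2) by (intro mult_le_mono1) simp
    then have "dsize (enc_ptree (translate \<psi> T)) \<le> M"
      using dsize_translate[OF trace(2) n(1,2)] unfolding M_def by linarith
    then obtain t where "t \<le> (n * (2000 * (n + 1)\<^sup>2) + 10) * M"
      "runs prog (enc_input (\<psi>, T)) (enc_ptree (translate \<psi> T)) t"
      using costs_runs[OF costs_main[OF trace(2) _ n_def, of M]] trace(1)
      by (auto simp: M_def qcbf_def)
    moreover have "(n * (2000 * (n + 1)\<^sup>2) + 10) * M \<le> 4000000 * n ^ 6"
      unfolding M_def by (rule polynomial_bound[OF n(3)])
    ultimately show ?thesis
      unfolding n_def[symmetric] by (meson order.trans trans_le_add1)
  qed
  then show ?thesis
    unfolding polytime_computable_on_def by (intro exI[of _ prog] exI[of _ 4000000] exI[of _ 6]) auto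
qed

theorem theoremB2:
  shows "\<exists>translation :: qform \<times> trace \<Rightarrow> ptree.
    (\<forall>\<psi> T. qcbf \<psi> \<longrightarrow> is_trace \<psi> T \<longrightarrow> label T = ({}, Map.empty) \<longrightarrow>
       tree_like_empty_clause_proof \<psi> (translation (\<psi>, T)) \<and>
       non_flow (translation (\<psi>, T)) = nodes T) \<and>
    polytime_computable_on
      {(\<psi>, T). qcbf \<psi> \<and> is_trace \<psi> T \<and> label T = ({}, Map.empty)}
      enc_input enc_ptree translation"
  using translate_empty_clause_proof translate_polytime
  by (intro exI[of _ "\<lambda>(\<psi>, T). translate \<psi> T"]) auto

end
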